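(* Let $(\mathcal H_k,\delta_i)_{k,i}$ be a semi-cosimplicial Hilbert space (SCH). The following assertions are equivalent: (a) $(\mathcal H_k,\delta_i)_{k,i}$ is symmetric and saturated (i.e. it is the canonical SCH of a unitary representation of the infinite symmetric group $\mathbb S_\infty$). (b) $(\mathcal H_k,\delta_i)_{k,i}$ is braided and saturated (i.e. it is the canonical SCH of a unitary representation of the infinite braid group $\mathbb B_\infty$). (c) $(\mathcal H_k,\delta_i)_{k,i}$ is normal, i.e. $\delta_{j-1}\delta_i^*=\delta_i^*\delta_j:\mathcal H_k\to\mathcal H_k$ for all $k\ge 0$ and $0\le i<j\le k+1$. (d) $\delta_j\big(\mathcal H_k\ominus\delta_i(\mathcal H_{k-1})\big)\subset\mathcal H_{k+1}\ominus\delta_i(\mathcal H_k)$ for all $k\ge0$ and $0\le i<j\le k+1$ with $i\le k$. (e) The labeled subspaces $L_\chi$, $\chi\in\Lambda_S^0$, are pairwise orthogonal (for distinct labels).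
   Context: A semi-cosimplicial Hilbert space (SCH) $(\mathcal H_k,\delta_i)_{k,i}$ is a sequence $(\mathcal H_k)_{k\ge -1}$ of Hilbert spaces together with linear isometries $\delta_i:\mathcal H_{n-1}\to\mathcal H_n$ (for all $n\in\mathbb N_0=\{0,1,2,\dots\}$ and $i=0,\dots,n$; the dependence on $n$ is suppressed) satisfying $\delta_j\delta_i=\delta_i\delta_{j-1}$ for $0\le i<j\le n$. The maps $\delta_n:\mathcal H_{n-1}\to\mathcal H_n$ (top index) are regarded as embeddings, giving a tower $\mathcal H_{-1}\subset\mathcal H_0\subset\cdots$; $\mathcal H_\infty$ is the closure of $\bigcup_{k\ge-1}\mathcal H_k$. The associated partial shifts are the isometries $\alpha_n$ on $\mathcal H_\infty$ ($n\in\mathbb N_0$) determined by $\alpha_n|_{\mathcal H_k}=\delta_n:\mathcal H_k\to\mathcal H_{k+1}$ for $k\ge n-1$. The SCH is saturated if $\mathcal H_{n-1}=\mathcal H_\infty^{\alpha_n}$ (fixed point space) for all $n\in\mathbb N_0$. The saturation of an SCH is the saturated SCH on the same $\mathcal H_\infty$ with the same partial shifts and with tower $\hat{\mathcal H}_k:=\mathcal H_\infty^{\alpha_{k+1}}$. Canonical SCH: $\mathbb B_\infty$ has generators $\sigma_m$, $m\ge1$, with relations $\sigma_m\sigma_{m+1}\sigma_m=\sigma_{m+1}\sigma_m\sigma_{m+1}$ and $\sigma_m\sigma_n=\sigma_n\sigma_m$ for $|m-n|\ge2$; $\mathbb S_\infty$ is the quotient by $\sigma_m^2=1$ (finite permutations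 of $\mathbb N_0$, $\sigma_m$ being the transposition of $m-1$ and $m$). Given a unitary representation of $\mathbb B_\infty$ (or of $\mathbb S_\infty$) on a Hilbert space $\mathcal H$, with $\sigma_m$ also denoting the representing unitaries, put $\hat{\mathcal H}_k:=\{x\in\mathcal H:\sigma_\ell x=x\ \forall\,\ell\ge k+2\}$ for $k\ge-1$ and $\hat{\mathcal H}_\infty:=\overline{\bigcup_k\hat{\mathcal H}_k}$. The isometries $\alpha_n:=\text{sot-}\lim_{m\to\infty}\sigma_{n+1}\sigma_{n+2}\cdots\sigma_m$ on $\hat{\mathcal H}_\infty$ satisfy $\alpha_j\alpha_i=\alpha_i\alpha_{j-1}$ for $i<j$, and the SCH with tower $(\hat{\mathcal H}_k)$ and coface operators $\delta_i=\alpha_i|_{\hat{\mathcal H}_{n-1}}:\hat{\mathcal H}_{n-1}\to\hat{\mathcal H}_n$ is called the canonical SCH of the representation. An SCH is called braided (resp. symmetric) if its saturation is the canonical SCH of a unitary representation of $\mathbb B_\infty$ (resp. $\mathbb S_\infty$). Labels: $\Lambda_S^0$ is the set of finite subsets of $\mathbb N_0$, each identified with its characteristic function $\chi:\mathbb N_0\to\{0,1\}$ (a label). The rank is $|\chi|=\#\{i:\chi_i=1\}$; the level is $\ell(\chi)=\max\{i:\chi_i=1\}$, or $-1$ if $\chi=0$. The root of $\chi$ is $\underline\chi$, the label of $\{0,1,\dots,|\chi|-1\}$ (level $|\chi|-1$). For a root $\underline\chi$ of level $k$, $L_{\underline\chi}:=\{x\in\mathcal H_k:x\perp\delta_i(\mathcal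 H_{k-1})\text{ for }i=0,\dots,k\}$ (with $L_{\underline\chi}=\mathcal H_{-1}$ for $k=-1$). For a general label $\chi$ of level $n$ with root of level $m$, write $\{0,\dots,n\}\setminus\{i:\chi_i=1\}=\{i_1<\dots<i_{n-m}\}$ and put $L_\chi:=\delta_{i_{n-m}}\cdots\delta_{i_1}L_{\underline\chi}\subset\mathcal H_n\subset\mathcal H_\infty$. The $L_\chi$ are the labeled subspaces. *)

theory Defs
  imports "HOL-Analysis.Analysis" "HOL-Algebra.Bij"
begin

section \<open>Complex Hilbert spaces\<close>

text \<open>
  The inner product is linear in its first argument. The axiom \<open>cinner_self\<close> ties it to the norm,
  so positive definiteness follows from the norm axioms.
\<close>

class chilbert_space = real_normed_vector + complete_space +
  fixes scaleC :: "complex \<Rightarrow> 'a \<Rightarrow> 'a" (infixr "*\<^sub>C" 75)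
    and cinner :: "'a \<Rightarrow> 'a \<Rightarrow> complex"
  assumes scaleC_add_right: "c *\<^sub>C (x + y) = c *\<^sub>C x + c *\<^sub>C y"
    and scaleC_add_left: "(c + d) *\<^sub>C x = c *\<^sub>C x + d *\<^sub>C x"
    and scaleC_scaleC: "c *\<^sub>C (d *\<^sub>C x) = (c * d) *\<^sub>C x"
    and scaleC_of_real: "complex_of_real r *\<^sub>C x = r *\<^sub>R x"
    and cinner_commute: "cinner x y = cnj (cinner y x)"
    and cinner_add_left: "cinner (x + y) z = cinner x z + cinner y z"
    and cinner_scaleC_left: "cinner (c *\<^sub>C x) y = c * cinner x y"
    and cinner_self: "cinner x x = complex_of_real ((norm x)\<^sup>2)"

instantiation complex :: chilbert_space
begin

definition scaleC_complex :: "complex \<Rightarrow> complex \<Rightarrow> complex"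
  where "scaleC_complex c x = c * x"

definition cinner_complex :: "complex \<Rightarrow> complex \<Rightarrow> complex"
  where "cinner_complex x y = x * cnj y"

instance
  by standard
    (auto simp: scaleC_complex_def cinner_complex_def algebra_simps scaleR_conv_of_real
      simp flip: complex_norm_square)

end

definition csubspace :: "'a::chilbert_space set \<Rightarrow> bool"
  where "csubspace S \<longleftrightarrow>
    0 \<in> S \<and> (\<forall>x\<in>S. \<forall>y\<in>S. x + y \<in> S) \<and> (\<forall>c. \<forall>x\<in>S. c *\<^sub>C x \<in> S)"

definition linear_isometry_on ::
    "'a::chilbert_space set \<Rightarrow> 'b::chilbert_space set \<Rightarrow> ('a \<Rightarrow> 'b) \<Rightarrow> bool"
  where "linear_isometry_on S T f \<longleftrightarrow>
    f ` S \<subseteq> T \<and>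
    (\<forall>x\<in>S. \<forall>y\<in>S. f (x + y) = f x + f y) \<and>
    (\<forall>c. \<forall>x\<in>S. f (c *\<^sub>C x) = c *\<^sub>C f x) \<and>
    (\<forall>x\<in>S. norm (f x) = norm x)"

definition orthogonal_sets :: "'a::chilbert_space set \<Rightarrow> 'a set \<Rightarrow> bool"
  where "orthogonal_sets S T \<longleftrightarrow> (\<forall>x\<in>S. \<forall>y\<in>T. cinner x y = 0)"

definition ominus :: "'a::chilbert_space set \<Rightarrow> 'a set \<Rightarrow> 'a set" (infixl "\<ominus>\<^sub>H" 65)
  where "S \<ominus>\<^sub>H T = {x\<in>S. \<forall>y\<in>T. cinner x y = 0}"

text \<open>The adjoint \<open>T \<rightarrow> S\<close> of a bounded operator \<open>f : S \<rightarrow> T\<close> between closed subspaces.\<close>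

definition adjoint_on ::
    "'a::chilbert_space set \<Rightarrow> ('a \<Rightarrow> 'b::chilbert_space) \<Rightarrow> 'b \<Rightarrow> 'a"
  where "adjoint_on S f y = (THE x. x \<in> S \<and> (\<forall>z\<in>S. cinner (f z) y = cinner z x))"


section \<open>Semi-cosimplicial Hilbert spaces\<close>

text \<open>
  Indices are shifted by one to avoid the index \<open>-1\<close>: \<open>H n\<close> stands for \<open>\<H>\<^sub>n\<^sub>-\<^sub>1\<close>, and
  \<open>\<delta> n i\<close>, for \<open>i \<le> n\<close>, for the coface operator \<open>\<delta>\<^sub>i : \<H>\<^sub>n\<^sub>-\<^sub>1 \<rightarrow> \<H>\<^sub>n\<close>.

  The \<open>H n\<close> are closed subspaces of one Hilbert space type in arbitrary position. Any sequence of
  Hilbert spaces is of this form (take the Hilbert direct sum), and no relation between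
  the \<open>H n\<close> inside that type is used.
\<close>

definition sch ::
    "(nat \<Rightarrow> 'a::chilbert_space set) \<Rightarrow> (nat \<Rightarrow> nat \<Rightarrow> 'a \<Rightarrow> 'a) \<Rightarrow> bool"
  where "sch H \<delta> \<longleftrightarrow>
    (\<forall>n. csubspace (H n) \<and> closed (H n)) \<and>
    (\<forall>n. \<forall>i\<le>n. linear_isometry_on (H n) (H (Suc n)) (\<delta> n i)) \<and>
    (\<forall>n i j. i < j \<and> j \<le> Suc n \<longrightarrow>
      (\<forall>x\<in>H n. \<delta> (Suc n) j (\<delta> n i x) = \<delta> (Suc n) i (\<delta> n (j - 1) x)))"

text \<open>
  Regarding the top coface operators as embeddings means realizing all spaces inside one Hilbert
  space by isometries \<open>\<iota> n\<close> that turn \<open>\<delta> n n\<close> into an inclusion. Such a realization always exists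
  (the completed direct limit) and is unique up to a unitary on the closure of the union.
\<close>

definition tower_embedding ::
    "(nat \<Rightarrow> 'a::chilbert_space set) \<Rightarrow> (nat \<Rightarrow> nat \<Rightarrow> 'a \<Rightarrow> 'a) \<Rightarrow>
      (nat \<Rightarrow> 'a \<Rightarrow> 'b::chilbert_space) \<Rightarrow> bool"
  where "tower_embedding H \<delta> \<iota> \<longleftrightarrow>
    (\<forall>n. linear_isometry_on (H n) UNIV (\<iota> n)) \<and>
    (\<forall>n. \<forall>x\<in>H n. \<iota> (Suc n) (\<delta> n n x) = \<iota> n x)"

definition H_infinity ::
    "(nat \<Rightarrow> 'a::chilbert_space set) \<Rightarrow> (nat \<Rightarrow> 'a \<Rightarrow> 'b::chilbert_space) \<Rightarrow> 'b set"
  where "H_infinity H \<iota> = closure (\<Union>n. \<iota> n ` H n)"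

text \<open>
  The defining conditions determine \<open>partial_shift H \<delta> \<iota> n\<close> on \<open>H_infinity H \<iota>\<close>; its values
  elsewhere are irrelevant.
\<close>

definition partial_shift ::
    "(nat \<Rightarrow> 'a::chilbert_space set) \<Rightarrow> (nat \<Rightarrow> nat \<Rightarrow> 'a \<Rightarrow> 'a) \<Rightarrow>
      (nat \<Rightarrow> 'a \<Rightarrow> 'b::chilbert_space) \<Rightarrow> nat \<Rightarrow> 'b \<Rightarrow> 'b"
  where "partial_shift H \<delta> \<iota> n =
    (SOME a. linear_isometry_on (H_infinity H \<iota>) (H_infinity H \<iota>) a \<and>
      (\<forall>k\<ge>n. \<forall>x\<in>H k. a (\<iota> k x) = \<iota> (Suc k) (\<delta> k n x)))"

text \<open>The shifted tower of the saturation; its coface operators are the partial shifts.\<close>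

definition saturation_tower ::
    "(nat \<Rightarrow> 'a::chilbert_space set) \<Rightarrow> (nat \<Rightarrow> nat \<Rightarrow> 'a \<Rightarrow> 'a) \<Rightarrow>
      (nat \<Rightarrow> 'a \<Rightarrow> 'b::chilbert_space) \<Rightarrow> nat \<Rightarrow> 'b set"
  where "saturation_tower H \<delta> \<iota> n = {x\<in>H_infinity H \<iota>. partial_shift H \<delta> \<iota> n x = x}"

definition saturated_sch ::
    "(nat \<Rightarrow> 'a::chilbert_space set) \<Rightarrow> (nat \<Rightarrow> nat \<Rightarrow> 'a \<Rightarrow> 'a) \<Rightarrow>
      (nat \<Rightarrow> 'a \<Rightarrow> 'b::chilbert_space) \<Rightarrow> bool"
  where "saturated_sch H \<delta> \<iota> \<longleftrightarrow> (\<forall>n. \<iota> n ` H n = saturation_tower H \<delta> \<iota> n)"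


section \<open>The infinite braid and symmetric groups\<close>

text \<open>
  The letters \<open>(m, True)\<close> and \<open>(m, False)\<close>, \<open>m \<ge> 1\<close>, stand for \<open>\<sigma>\<^sub>m\<close> and its inverse.
\<close>

type_synonym braid_word = "(nat \<times> bool) list"

definition braid_words :: "braid_word set"
  where "braid_words = lists ({1..} \<times> UNIV)"

inductive braid_eq :: "braid_word \<Rightarrow> braid_word \<Rightarrow> bool"
  where
    refl: "w \<in> braid_words \<Longrightarrow> braid_eq w w"
  | sym: "braid_eq v w \<Longrightarrow> braid_eq w v"
  | trans: "braid_eq u v \<Longrightarrow> braid_eq v w \<Longrightarrow> braid_eq u w"
  | append: "braid_eq v v' \<Longrightarrow> braid_eq w w' \<Longrightarrow> braid_eq (v @ w) (v' @ w')"
  | cancel: "m \<ge> 1 \<Longrightarrow> braid_eq [(m, b), (m, \<not> b)] []"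
  | braid: "m \<ge> 1 \<Longrightarrow>
      braid_eq [(m, True), (m + 1, True), (m, True)] [(m + 1, True), (m, True), (m + 1, True)]"
  | commute: "m \<ge> 1 \<Longrightarrow> n \<ge> m + 2 \<Longrightarrow>
      braid_eq [(m, True), (n, True)] [(n, True), (m, True)]"

definition braid_class :: "braid_word \<Rightarrow> braid_word set"
  where "braid_class w = {v. braid_eq w v}"

definition braid_group :: "braid_word set monoid"
  where "braid_group =
    \<lparr>carrier = braid_class ` braid_words,
     mult = \<lambda>X Y. \<Union>u\<in>X. \<Union>v\<in>Y. braid_class (u @ v),
     one = braid_class []\<rparr>"

lemma braid_class_eq_iff: "u \<in> braid_words \<Longrightarrow> braid_class u = braid_class v \<longleftrightarrow> braid_eq u v"
  unfolding braid_class_def by (blast intro: braid_eq.intros)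

lemma braid_mult:
  assumes "u \<in> braid_words" "v \<in> braid_words"
  shows "braid_class u \<otimes>\<^bsub>braid_group\<^esub> braid_class v = braid_class (u @ v)"
proof -
  have "(\<Union>x\<in>braid_class u. \<Union>y\<in>braid_class v. braid_class (x @ y)) = braid_class (u @ v)"
    using assms unfolding braid_class_def by (auto intro: braid_eq.intros)
  then show ?thesis by (simp add: braid_group_def)
qed

lemma braid_inverse: "w \<in> braid_words \<Longrightarrow> \<exists>v\<in>braid_words. braid_eq (v @ w) []"
proof (induction w)
  case Nil then show ?case by (auto intro!: bexI[of _ "[]"] braid_eq.refl simp: braid_words_def)
next
  case (Cons a w)
  obtain m b where a: "a = (m,b)" by force
  from Cons have w: "w \<in> braid_words" and m: "m \<ge> 1" by (auto simp: braid_words_def a)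
  with Cons obtain v where v: "v \<in> braid_words" "braid_eq (v @ w) []" by blast
  have 1: "braid_eq ([(m, \<not>b)] @ [(m, b)]) []" using braid_eq.cancel[OF m, of "\<not>b"] by simp
  have 2: "braid_eq (v @ ([(m, \<not>b)] @ [(m, b)]) @ w) (v @ [] @ w)"
    using v w by (intro braid_eq.append 1 braid_eq.refl)
  then have "braid_eq ((v @ [(m, \<not>b)]) @ (a # w)) []" using v(2) a by (auto intro: braid_eq.trans)
  moreover have "v @ [(m, \<not>b)] \<in> braid_words" using v m by (auto simp: braid_words_def)
  ultimately show ?case by blast
qed

lemma group_braid_group: "group braid_group"
proof -
  have app: "u @ v \<in> braid_words" if "u \<in> braid_words" "v \<in> braid_words" for u v
    using that by (auto simp: braid_words_def)
  have nil: "[] \<in> braid_words" by (auto simp: braid_words_def)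
  have carrier: "carrier braid_group = braid_class ` braid_words"
    and one: "\<one>\<^bsub>braid_group\<^esub> = braid_class []"
    by (simp_all add: braid_group_def)
  show ?thesis
    by (rule groupI) (auto simp: carrier one braid_mult app nil braid_class_eq_iff braid_inverse)
qed

definition braid_gen :: "nat \<Rightarrow> braid_word set"
  where "braid_gen m = braid_class [(m, True)]"

definition infinite_symmetric_group :: "(nat \<Rightarrow> nat) monoid"
  where "infinite_symmetric_group =
    \<lparr>carrier = {p. bij p \<and> finite {i. p i \<noteq> i}}, mult = (\<circ>), one = id\<rparr>"

definition symmetric_gen :: "nat \<Rightarrow> nat \<Rightarrow> nat"
  where "symmetric_gen m = Transposition.transpose (m - 1) m"


section \<open>Canonical semi-cosimplicial Hilbert spaces\<close>

definition unitary_group :: "'b::chilbert_space set \<Rightarrow> ('b \<Rightarrow> 'b) monoid"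
  where "unitary_group K = (BijGroup K)\<lparr>carrier := {u \<in> Bij K. linear_isometry_on K K u}\<rparr>"

definition unitary_rep :: "('g, 'm) monoid_scheme \<Rightarrow> 'b::chilbert_space set \<Rightarrow> ('g \<Rightarrow> 'b \<Rightarrow> 'b) \<Rightarrow> bool"
  where "unitary_rep G K U \<longleftrightarrow> csubspace K \<and> closed K \<and> U \<in> hom G (unitary_group K)"

text \<open>
  Here \<open>\<sigma> m\<close>, \<open>m \<ge> 1\<close>, are the unitaries on \<open>K\<close> representing the generators. With the index shift,
  the condition \<open>l \<ge> k + 2\<close> for \<open>\<H>\<^sub>k\<close> becomes \<open>l > n\<close>.
\<close>

definition canonical_tower ::
    "'b::chilbert_space set \<Rightarrow> (nat \<Rightarrow> 'b \<Rightarrow> 'b) \<Rightarrow> nat \<Rightarrow> 'b set"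
  where "canonical_tower K \<sigma> n = {x\<in>K. \<forall>l>n. \<sigma> l x = x}"

text \<open>The pointwise norm limit of \<open>\<sigma> (n + 1) \<circ> \<dots> \<circ> \<sigma> m\<close> for \<open>m \<rightarrow> \<infinity>\<close>.\<close>

definition canonical_shift :: "(nat \<Rightarrow> 'b::chilbert_space \<Rightarrow> 'b) \<Rightarrow> nat \<Rightarrow> 'b \<Rightarrow> 'b"
  where "canonical_shift \<sigma> n x = lim (\<lambda>m. foldr \<sigma> [Suc n..<Suc m] x)"

text \<open>
  The saturation of the given SCH equals the canonical SCH: same tower and same coface operators.
\<close>

definition saturation_is_canonical ::
    "(nat \<Rightarrow> 'a::chilbert_space set) \<Rightarrow> (nat \<Rightarrow> nat \<Rightarrow> 'a \<Rightarrow> 'a) \<Rightarrow>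
      (nat \<Rightarrow> 'a \<Rightarrow> 'b::chilbert_space) \<Rightarrow> 'b set \<Rightarrow> (nat \<Rightarrow> 'b \<Rightarrow> 'b) \<Rightarrow> bool"
  where "saturation_is_canonical H \<delta> \<iota> K \<sigma> \<longleftrightarrow>
    (\<forall>n. saturation_tower H \<delta> \<iota> n = canonical_tower K \<sigma> n) \<and>
    (\<forall>n. \<forall>i\<le>n. \<forall>x\<in>canonical_tower K \<sigma> n. partial_shift H \<delta> \<iota> i x = canonical_shift \<sigma> i x)"

text \<open>
  The representation space is a closed subspace of the type containing \<open>H_infinity H \<iota>\<close>. This
  loses nothing: a representation leaves the closure of the union of its canonical tower invariant,
  and restricting it to that closure does not change its canonical SCH.
\<close>

definition braided_sch ::
    "(nat \<Rightarrow> 'a::chilbert_space set) \<Rightarrow> (nat \<Rightarrow> nat \<Rightarrow> 'a \<Rightarrow> 'a) \<Rightarrow>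
      (nat \<Rightarrow> 'a \<Rightarrow> 'b::chilbert_space) \<Rightarrow> bool"
  where "braided_sch H \<delta> \<iota> \<longleftrightarrow>
    (\<exists>K U. unitary_rep braid_group K U \<and>
      saturation_is_canonical H \<delta> \<iota> K (\<lambda>m. U (braid_gen m)))"

definition symmetric_sch ::
    "(nat \<Rightarrow> 'a::chilbert_space set) \<Rightarrow> (nat \<Rightarrow> nat \<Rightarrow> 'a \<Rightarrow> 'a) \<Rightarrow>
      (nat \<Rightarrow> 'a \<Rightarrow> 'b::chilbert_space) \<Rightarrow> bool"
  where "symmetric_sch H \<delta> \<iota> \<longleftrightarrow>
    (\<exists>K U. unitary_rep infinite_symmetric_group K U \<and>
      saturation_is_canonical H \<delta> \<iota> K (\<lambda>m. U (symmetric_gen m)))"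


section \<open>Normality\<close>

text \<open>
  With \<open>H (Suc k)\<close> standing for \<open>\<H>\<^sub>k\<close>, \<open>k \<ge> 0\<close>: on the left, \<open>\<delta>\<^sub>i\<^sup>* : \<H>\<^sub>k \<rightarrow> \<H>\<^sub>k\<^sub>-\<^sub>1\<close> and
  \<open>\<delta>\<^sub>j\<^sub>-\<^sub>1 : \<H>\<^sub>k\<^sub>-\<^sub>1 \<rightarrow> \<H>\<^sub>k\<close>; on the right, \<open>\<delta>\<^sub>j : \<H>\<^sub>k \<rightarrow> \<H>\<^sub>k\<^sub>+\<^sub>1\<close> and \<open>\<delta>\<^sub>i\<^sup>* : \<H>\<^sub>k\<^sub>+\<^sub>1 \<rightarrow> \<H>\<^sub>k\<close>.
\<close>

definition normal_sch ::
    "(nat \<Rightarrow> 'a::chilbert_space set) \<Rightarrow> (nat \<Rightarrow> nat \<Rightarrow> 'a \<Rightarrow> 'a) \<Rightarrow> bool"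
  where "normal_sch H \<delta> \<longleftrightarrow>
    (\<forall>k i j. i < j \<and> j \<le> k + 1 \<longrightarrow>
      (\<forall>x\<in>H (Suc k).
        \<delta> k (j - 1) (adjoint_on (H k) (\<delta> k i) x) =
        adjoint_on (H (Suc k)) (\<delta> (Suc k) i) (\<delta> (Suc k) j x)))"


section \<open>Labeled subspaces\<close>

text \<open>A label is a finite set \<open>A\<close> of natural numbers; \<open>shifted_level A\<close> is its level plus one.\<close>

definition shifted_level :: "nat set \<Rightarrow> nat"
  where "shifted_level A = (if A = {} then 0 else Suc (Max A))"

text \<open>The subspace for the root of rank \<open>r\<close>, i.e.\ of level \<open>r - 1\<close>, inside \<open>H r\<close>.\<close>

definition root_subspace ::
    "(nat \<Rightarrow> 'a::chilbert_space set) \<Rightarrow> (nat \<Rightarrow> nat \<Rightarrow> 'a \<Rightarrow> 'a) \<Rightarrow> nat \<Rightarrow> 'a set"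
  where "root_subspace H \<delta> r = {x\<in>H r. \<forall>i<r. \<forall>y\<in>H (r - 1). cinner x (\<delta> (r - 1) i y) = 0}"

text \<open>\<open>cofaces \<delta> r [i\<^sub>1, \<dots>, i\<^sub>s]\<close> is \<open>\<delta>\<^bsub>i\<^sub>s\<^esub> \<cdots> \<delta>\<^bsub>i\<^sub>1\<^esub>\<close> starting on \<open>H r\<close>.\<close>

primrec cofaces :: "(nat \<Rightarrow> nat \<Rightarrow> 'a \<Rightarrow> 'a) \<Rightarrow> nat \<Rightarrow> nat list \<Rightarrow> 'a \<Rightarrow> 'a"
  where
    "cofaces \<delta> r [] x = x"
  | "cofaces \<delta> r (i # is) x = cofaces \<delta> (Suc r) is (\<delta> r i x)"

definition labeled_subspace ::
    "(nat \<Rightarrow> 'a::chilbert_space set) \<Rightarrow> (nat \<Rightarrow> nat \<Rightarrow> 'a \<Rightarrow> 'a) \<Rightarrow>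
      (nat \<Rightarrow> 'a \<Rightarrow> 'b::chilbert_space) \<Rightarrow> nat set \<Rightarrow> 'b set"
  where "labeled_subspace H \<delta> \<iota> A =
    \<iota> (shifted_level A) `
      cofaces \<delta> (card A) (sorted_list_of_set ({..<shifted_level A} - A)) `
        root_subspace H \<delta> (card A)"

end

theory Submission
  imports Defs
begin

text \<open>
  Condition (d) is normality tested on orthogonal complements of the coface ranges. Every tower
  space is the closed span of the labeled subspaces of its labels, and \<open>\<alpha>\<^sub>i\<close> acts on
  labels by inserting a zero at position \<open>i\<close>. For a normal tower a vector with label \<open>A\<close> is
  orthogonal to the range of \<open>\<alpha>\<^sub>i\<close> for \<open>i \<in> A\<close> and lies in it for \<open>i \<notin> A\<close>,
  which gives (e); conversely, (e) describes the complement of the range of \<open>\<alpha>\<^sub>i\<close> as the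
  span of the labels containing \<open>i\<close>, which gives (d). Under (e), permuting labels defines a unitary
  representation of the infinite symmetric group. A vector of the limit space fixed by
  \<open>\<alpha>\<^sub>n\<close> lies in the \<open>n\<close>-th space, because its inner product with a vector of any other label is
  constant along an infinite orthogonal orbit. In a braided tower the relation
  \<open>\<alpha>\<^sub>i \<sigma>\<^sub>l = \<sigma>\<^bsub>l+1\<^esub> \<alpha>\<^sub>i\<close> for \<open>l > i\<close>
  shows that the adjoint of \<open>\<alpha>\<^sub>i\<close> respects the tower, and this forces (d).
\<close>

section \<open>Geometry of complex Hilbert spaces\<close>

text \<open>The labeled subspaces span every tower space without any hypothesis, so only their
  orthogonality is in question. Once it holds, an injection of positions preserves all inner
  products between labeled vectors and therefore extends to an isometry; identities between such
  operators reduce to identities between maps of finite sets. Two obstacles shape the rest.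
  Conditions (c) and (d) concern one level at a time, while the arguments with labels need
  orthogonality to the whole range of a partial shift; under (d) the passage rests on
  \<open>\<alpha> n\<close> fixing \<open>T n\<close>. Moreover, a vector fixed by generators or by
  a partial shift is not known in advance to lie in a tower space, and only there is a partial shift
  a finite product of generators. Such vectors are reached through inner products with tower
  vectors, that is, through adjoints and the equality case of Cauchy-Schwarz. Saturation enters on
  the way from (b) to (d): being braided describes the tower of the saturation only.\<close>

lemma scaleC_zero_right [simp]: "c *\<^sub>C (0::'a::chilbert_space) = 0"
  using scaleC_add_right[of c 0 "0::'a"] by simp

lemma scaleC_minus_one: "(-1) *\<^sub>C x = - (x::'a::chilbert_space)"
  using scaleC_of_real[of "-1" x] by simp

lemma scaleC_minus_right: "c *\<^sub>C (- x) = - (c *\<^sub>C (x::'a::chilbert_space))"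
  using scaleC_add_right[of c x "- x"] by (simp add: eq_neg_iff_add_eq_0 add.commute)

lemma scaleC_diff_right: "c *\<^sub>C (x - y) = c *\<^sub>C x - c *\<^sub>C (y::'a::chilbert_space)"
  using scaleC_add_right[of c x "- y"] by (simp add: scaleC_minus_right)

lemma cinner_add_right: "cinner x (y + z) = cinner x y + cinner x (z::'a::chilbert_space)"
  by (metis cinner_add_left cinner_commute complex_cnj_add)

lemma cinner_scaleC_right: "cinner x (c *\<^sub>C y) = cnj c * cinner x (y::'a::chilbert_space)"
  by (metis cinner_scaleC_left cinner_commute complex_cnj_mult)

lemma cinner_eq_zero_commute: "cinner x y = 0 \<longleftrightarrow> cinner y (x::'a::chilbert_space) = 0"
  by (metis cinner_commute complex_cnj_zero)

lemma cinner_self_eq_zero [simp]: "cinner x x = 0 \<longleftrightarrow> (x::'a::chilbert_space) = 0"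
  by (simp add: cinner_self)

lemma norm_scaleC: "norm (c *\<^sub>C x) = cmod c * norm (x::'a::chilbert_space)"
proof -
  have "complex_of_real ((norm (c *\<^sub>C x))\<^sup>2) = c * cnj c * complex_of_real ((norm x)\<^sup>2)"
    by (simp only: cinner_self[symmetric] cinner_scaleC_left cinner_scaleC_right mult_ac)
  also have "\<dots> = complex_of_real ((cmod c * norm x)\<^sup>2)"
    by (simp add: complex_norm_square power_mult_distrib flip: of_real_power)
  finally show ?thesis
    by (metis of_real_eq_iff power2_eq_imp_eq norm_ge_zero mult_nonneg_nonneg)
qed

lemma norm_add_square:
  "(norm (x + y))\<^sup>2 = (norm x)\<^sup>2 + (norm y)\<^sup>2 + 2 * Re (cinner x (y::'a::chilbert_space))"
proof -
  have "complex_of_real ((norm (x + y))\<^sup>2) =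
      complex_of_real ((norm x)\<^sup>2) + complex_of_real ((norm y)\<^sup>2) + (cinner x y + cnj (cinner x y))"
    by (simp only: cinner_self[symmetric] cinner_add_left cinner_add_right cinner_commute[of y x]
        add_ac)
  also have "\<dots> = complex_of_real ((norm x)\<^sup>2 + (norm y)\<^sup>2 + 2 * Re (cinner x y))"
    by (simp add: complex_add_cnj)
  finally show ?thesis
    by (simp only: of_real_eq_iff)
qed

lemma cinner_Cauchy_Schwarz: "cmod (cinner x y) \<le> norm x * norm (y::'a::chilbert_space)"
proof (cases "y = 0")
  case True
  then show ?thesis
    using cinner_add_right[of x 0 "0::'a"] by simp
next
  case False
  define t where "t = (norm y)\<^sup>2"
  have t: "t > 0"
    using False by (simp add: t_def)
  define c where "c = cinner x y"
  \<comment> \<open>\<open>z\<close> is the component of \<open>x\<close> orthogonal to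
    \<open>y\<close>; the claim is \<open>0 \<le> (norm z)\<^sup>2\<close> written out.\<close>
  define z where "z = x + (- (c / t)) *\<^sub>C y"
  have zy: "cinner z y = 0"
    using t by (simp add: z_def cinner_add_left cinner_scaleC_left cinner_self c_def flip: t_def)
  have "complex_of_real ((norm z)\<^sup>2) = cinner z z"
    by (simp add: cinner_self)
  also have "\<dots> = cinner z x"
    using zy by (subst (2) z_def) (simp add: cinner_add_right cinner_scaleC_right)
  also have "\<dots> = complex_of_real ((norm x)\<^sup>2 - (cmod c)\<^sup>2 / t)"
    by (simp add: z_def cinner_add_left cinner_scaleC_left cinner_self cinner_commute[of y x]
        flip: c_def complex_norm_square)
  finally have "(norm z)\<^sup>2 = (norm x)\<^sup>2 - (cmod c)\<^sup>2 / t"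
    by (simp only: of_real_eq_iff)
  then have "(cmod c)\<^sup>2 / t \<le> (norm x)\<^sup>2"
    using zero_le_power2[of "norm z"] by linarith
  then have "(cmod c)\<^sup>2 \<le> (norm x * norm y)\<^sup>2"
    using t by (simp add: t_def power_mult_distrib field_simps)
  then show ?thesis
    by (simp add: c_def power2_le_iff_abs_le)
qed

text \<open>Over the reals a sesquilinear form is bilinear, which supplies continuity and the rules
  for sums and differences.\<close>

interpretation cinner: bounded_bilinear "cinner :: 'a::chilbert_space \<Rightarrow> 'a \<Rightarrow> complex"
proof
  fix r :: real and a b :: 'a
  show "cinner (r *\<^sub>R a) b = r *\<^sub>R cinner a b"
    by (simp add: cinner_scaleC_left scaleR_conv_of_real flip: scaleC_of_real)
  show "cinner a (r *\<^sub>R b) = r *\<^sub>R cinner a b"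
    by (simp add: cinner_scaleC_right scaleR_conv_of_real flip: scaleC_of_real)
  show "\<exists>K. \<forall>a b::'a. cmod (cinner a b) \<le> norm a * norm b * K"
    by (rule exI[of _ 1]) (simp add: cinner_Cauchy_Schwarz)
qed (simp_all add: cinner_add_left cinner_add_right)

lemma norm_diff_square:
  "(norm (x - y))\<^sup>2 = (norm x)\<^sup>2 + (norm y)\<^sup>2 - 2 * Re (cinner x (y::'a::chilbert_space))"
  using norm_add_square[of x "- y"] by (simp add: cinner.minus_right)

lemma parallelogram_law:
  "(norm (x - y))\<^sup>2 + (norm (x + y))\<^sup>2 = 2 * (norm x)\<^sup>2 + 2 * (norm (y::'a::chilbert_space))\<^sup>2"
  by (simp add: norm_diff_square norm_add_square)

text \<open>Products make the graph of an isometry a closed subspace of a Hilbert space.\<close>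

instantiation prod :: (chilbert_space, chilbert_space) chilbert_space
begin

definition scaleC_prod :: "complex \<Rightarrow> 'a \<times> 'b \<Rightarrow> 'a \<times> 'b"
  where "scaleC_prod c p = (c *\<^sub>C fst p, c *\<^sub>C snd p)"

definition cinner_prod :: "'a \<times> 'b \<Rightarrow> 'a \<times> 'b \<Rightarrow> complex"
  where "cinner_prod p q = cinner (fst p) (fst q) + cinner (snd p) (snd q)"

instance
proof
  fix p q :: "'a \<times> 'b"
  show "cinner p q = cnj (cinner q p)"
    by (simp add: cinner_prod_def cinner_commute[of "fst p"] cinner_commute[of "snd p"])
  show "cinner p p = complex_of_real ((norm p)\<^sup>2)"
    by (simp add: cinner_prod_def cinner_self norm_prod_def)
qed (simp_all add: scaleC_prod_def cinner_prod_def scaleC_add_right scaleC_add_left scaleC_scaleC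
    scaleC_of_real cinner_add_left cinner_scaleC_left algebra_simps scaleR_prod_def)

end

section \<open>Closed subspaces and orthogonal projections\<close>

definition closed_csubspace :: "'a::chilbert_space set \<Rightarrow> bool"
  where "closed_csubspace S \<longleftrightarrow> csubspace S \<and> closed S"

lemma closed_csubspace_0: "closed_csubspace S \<Longrightarrow> 0 \<in> S"
  and closed_csubspace_add: "closed_csubspace S \<Longrightarrow> x \<in> S \<Longrightarrow> y \<in> S \<Longrightarrow> x + y \<in> S"
  and closed_csubspace_scaleC: "closed_csubspace S \<Longrightarrow> x \<in> S \<Longrightarrow> c *\<^sub>C x \<in> S"
  and closed_csubspace_closed: "closed_csubspace S \<Longrightarrow> closed S"
  by (auto simp: closed_csubspace_def csubspace_def)

lemma csubspace_diff:
  assumes "csubspace S" "x \<in> S" "y \<in> S"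
  shows "x - y \<in> S"
proof -
  have "(-1) *\<^sub>C y \<in> S"
    using assms by (auto simp: csubspace_def)
  then have "x + - y \<in> S"
    using assms unfolding csubspace_def scaleC_minus_one by blast
  then show ?thesis
    by simp
qed

lemma closed_csubspace_diff: "closed_csubspace S \<Longrightarrow> x \<in> S \<Longrightarrow> y \<in> S \<Longrightarrow> x - y \<in> S"
  by (simp add: closed_csubspace_def csubspace_diff)

lemma closed_csubspace_Inter:
  "(\<And>S. S \<in> F \<Longrightarrow> closed_csubspace S) \<Longrightarrow> closed_csubspace (\<Inter>F)"
  by (auto simp: closed_csubspace_def csubspace_def intro: closed_Inter)

lemma closed_csubspace_orthogonal: "closed_csubspace {x. cinner x y = 0}"
proof -
  have "closed {x. cinner x y = 0}"
    by (intro closed_Collect_eq continuous_intros cinner.continuous_on)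
  then show ?thesis
    by (simp add: closed_csubspace_def csubspace_def cinner_add_left cinner_scaleC_left
        cinner.zero_left)
qed

lemma closed_csubspace_closure:
  assumes "csubspace S"
  shows "closed_csubspace (closure S)"
proof -
  have "x + y \<in> closure S" if xy: "x \<in> closure S" "y \<in> closure S" for x y
  proof -
    obtain f g where "\<forall>n. f n \<in> S" "f \<longlonglongrightarrow> x" "\<forall>n. g n \<in> S" "g \<longlonglongrightarrow> y"
      using xy by (auto simp: closure_sequential)
    then have "\<forall>n. f n + g n \<in> S" "(\<lambda>n. f n + g n) \<longlonglongrightarrow> x + y"
      using assms by (auto simp: csubspace_def intro: tendsto_add)
    then show ?thesis
      unfolding closure_sequential by (intro exI[of _ "\<lambda>n. f n + g n"]) simp
  qed
  moreover have "c *\<^sub>C x \<in> closure S" if x: "x \<in> closure S" for x c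
  proof -
    obtain f where f: "\<forall>n. f n \<in> S" "f \<longlonglongrightarrow> x"
      using x by (auto simp: closure_sequential)
    have "(\<lambda>n. norm (f n - x)) \<longlonglongrightarrow> 0"
      using f(2) LIM_zero tendsto_norm_zero by blast
    then have "(\<lambda>n. cmod c * norm (f n - x)) \<longlonglongrightarrow> 0"
      by (rule tendsto_mult_right_zero)
    then have "(\<lambda>n. norm (c *\<^sub>C f n - c *\<^sub>C x)) \<longlonglongrightarrow> 0"
      by (simp only: norm_scaleC flip: scaleC_diff_right)
    then have "(\<lambda>n. c *\<^sub>C f n - c *\<^sub>C x) \<longlonglongrightarrow> 0"
      by (rule tendsto_norm_zero_cancel)
    then have "(\<lambda>n. c *\<^sub>C f n) \<longlonglongrightarrow> c *\<^sub>C x"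
      by (rule LIM_zero_cancel)
    moreover have "\<forall>n. c *\<^sub>C f n \<in> S"
      using f assms by (auto simp: csubspace_def)
    ultimately show ?thesis
      unfolding closure_sequential by (intro exI[of _ "\<lambda>n. c *\<^sub>C f n"]) simp
  qed
  moreover have "0 \<in> closure S"
    using assms closure_subset by (auto simp: csubspace_def)
  ultimately show ?thesis
    by (auto simp: closed_csubspace_def csubspace_def)
qed

text \<open>A minimizing sequence is Cauchy by the parallelogram law, since midpoints stay in
  \<open>S\<close>. At its limit no correction by an element of \<open>S\<close> can decrease the
  distance, which is orthogonality.\<close>

lemma orthogonal_projection:
  fixes S :: "'a::chilbert_space set"
  assumes S: "closed_csubspace S"
  obtains p where "p \<in> S" "\<And>s. s \<in> S \<Longrightarrow> cinner (x - p) s = 0"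
proof -
  define d where "d = infdist x S"
  have ne: "S \<noteq> {}"
    using closed_csubspace_0[OF S] by auto
  have d_le: "d \<le> norm (x - s)" if "s \<in> S" for s
    using infdist_le[OF that, of x] by (simp add: d_def dist_norm)
  have d0: "d \<ge> 0"
    by (simp add: d_def infdist_nonneg)
  have "\<exists>s\<in>S. norm (x - s) < d + 1 / real (Suc n)" for n
  proof (rule ccontr)
    assume "\<not> ?thesis"
    then have "d + 1 / real (Suc n) \<le> infdist x S"
      unfolding infdist_notempty[OF ne] by (intro cINF_greatest ne) (auto simp: dist_norm not_less)
    then show False
      by (simp add: d_def)
  qed
  then obtain s where s: "\<And>n. s n \<in> S" "\<And>n. norm (x - s n) < d + 1 / real (Suc n)"
    by metis
  have lim: "(\<lambda>n. d + 1 / real (Suc n)) \<longlonglongrightarrow> d"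
    using LIMSEQ_inverse_real_of_nat_add[of d] by (simp add: inverse_eq_divide)
  have close: "(norm (s m - s n))\<^sup>2 \<le> 4 * ((d + 1 / real (Suc N))\<^sup>2 - d\<^sup>2)"
    if mn: "m \<ge> N" "n \<ge> N" for m n N
  proof -
    have bound: "(norm (x - s k))\<^sup>2 \<le> (d + 1 / real (Suc N))\<^sup>2" if "k \<ge> N" for k
    proof -
      have "1 / real (Suc k) \<le> 1 / real (Suc N)"
        using that by (simp add: frac_le)
      then have "norm (x - s k) \<le> d + 1 / real (Suc N)"
        using s(2)[of k] by linarith
      then show ?thesis
        by (intro power_mono) auto
    qed
    \<comment> \<open>The midpoint is at distance at least \<open>d\<close> from \<open>x\<close>,
      which leaves little room for \<open>norm (s m - s n)\<close>.\<close>
    define u where "u = (1/2) *\<^sub>R (s m + s n)"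
    have "u \<in> S"
      using closed_csubspace_scaleC[OF S closed_csubspace_add[OF S s(1)[of m] s(1)[of n]],
          of "complex_of_real (1/2)"]
      unfolding u_def scaleC_of_real .
    have half: "(x - s m) + (x - s n) = 2 *\<^sub>R (x - u)"
      by (simp add: u_def scaleR_2 algebra_simps)
    have "d\<^sup>2 \<le> (norm (x - u))\<^sup>2"
      using d_le[OF \<open>u \<in> S\<close>] d0 by (intro power_mono) auto
    then have "4 * d\<^sup>2 \<le> (norm ((x - s m) + (x - s n)))\<^sup>2"
      unfolding half by (simp add: power_mult_distrib)
    moreover have "(norm (s n - s m))\<^sup>2 + (norm ((x - s m) + (x - s n)))\<^sup>2 =
        2 * (norm (x - s m))\<^sup>2 + 2 * (norm (x - s n))\<^sup>2"
      using parallelogram_law[of "x - s m" "x - s n"] by simp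
    ultimately show ?thesis
      using bound[OF mn(1)] bound[OF mn(2)] by (simp add: norm_minus_commute)
  qed
  have "(\<lambda>N. 4 * ((d + 1 / real (Suc N))\<^sup>2 - d\<^sup>2)) \<longlonglongrightarrow> 4 * (d\<^sup>2 - d\<^sup>2)"
    by (intro tendsto_intros lim)
  then have small: "\<exists>N. 4 * ((d + 1 / real (Suc N))\<^sup>2 - d\<^sup>2) < e\<^sup>2" if "e > 0" for e :: real
    using order_tendstoD(2)[of _ 0 sequentially "e\<^sup>2"] that
    by (fastforce simp: eventually_sequentially)
  have "Cauchy s"
  proof (rule metric_CauchyI)
    fix e :: real
    assume e: "e > 0"
    then obtain N where "4 * ((d + 1 / real (Suc N))\<^sup>2 - d\<^sup>2) < e\<^sup>2"
      using small by blast
    then have "(norm (s m - s n))\<^sup>2 < e\<^sup>2" if "m \<ge> N" "n \<ge> N" for m n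
      using close[OF that] by linarith
    then have "dist (s m) (s n) < e" if "m \<ge> N" "n \<ge> N" for m n
      using that power_less_imp_less_base[of _ 2 e] e unfolding dist_norm by auto
    then show "\<exists>N. \<forall>m\<ge>N. \<forall>n\<ge>N. dist (s m) (s n) < e"
      by blast
  qed
  then obtain p where p: "s \<longlonglongrightarrow> p"
    using Cauchy_convergent_iff convergent_def by blast
  have pS: "p \<in> S"
    using closed_sequentially[OF closed_csubspace_closed[OF S] s(1) p] .
  have "(\<lambda>n. norm (x - s n)) \<longlonglongrightarrow> norm (x - p)"
    by (intro tendsto_intros p)
  then have min: "norm (x - p) \<le> d"
    using s(2) by (intro LIMSEQ_le[OF _ lim]) (auto intro: less_imp_le)
  have "cinner (x - p) y = 0" if y: "y \<in> S" for y
  proof (cases "y = 0")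
    case True
    then show ?thesis
      by (simp add: cinner.zero_right)
  next
    case False
    define z where "z = x - p"
    define t where "t = (norm y)\<^sup>2"
    have t: "t > 0"
      using False by (simp add: t_def)
    define c where "c = cinner z y"
    \<comment> \<open>\<open>w\<close> is the projection of \<open>z\<close> onto the line of
      \<open>y\<close>: replacing \<open>p\<close> by \<open>p + w\<close> would lower the squared
      distance by \<open>(cmod c)\<^sup>2 / t\<close>.\<close>
    define w where "w = (c / t) *\<^sub>C y"
    have "p + w \<in> S"
      unfolding w_def by (intro closed_csubspace_add closed_csubspace_scaleC S pS y)
    then have "d \<le> norm (z - w)"
      using d_le[of "p + w"] by (simp add: z_def algebra_simps)
    then have "(norm z)\<^sup>2 \<le> (norm (z - w))\<^sup>2"
      using min by (intro power_mono) (auto simp: z_def)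
    moreover have "(norm w)\<^sup>2 = (cmod c)\<^sup>2 / t"
      using t by (simp add: w_def norm_scaleC norm_divide power_mult_distrib power_divide
          power2_eq_square[of t] flip: t_def)
    moreover have "cinner z w = complex_of_real ((cmod c)\<^sup>2 / t)"
      by (simp add: w_def cinner_scaleC_right mult.commute[of "cnj c"] flip: c_def complex_norm_square)
    ultimately have "(cmod c)\<^sup>2 / t \<le> 0"
      by (simp add: norm_diff_square)
    then show ?thesis
      using t by (simp add: c_def z_def divide_le_0_iff)
  qed
  with pS show thesis
    by (rule that)
qed

section \<open>Closed spans\<close>

definition closed_cspan :: "'a::chilbert_space set \<Rightarrow> 'a set"
  where "closed_cspan G = closed_csubspace hull G"

lemma closed_csubspace_closed_cspan: "closed_csubspace (closed_cspan G)"
  unfolding closed_cspan_def by (rule hull_in) (auto intro: closed_csubspace_Inter)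

lemma closed_cspan_superset: "G \<subseteq> closed_cspan G"
  unfolding closed_cspan_def by (rule hull_subset)

lemma closed_cspan_base: "x \<in> G \<Longrightarrow> x \<in> closed_cspan G"
  using closed_cspan_superset by blast

text \<open>The density principle behind most arguments below: a property that holds on the
  generators and cuts out a closed subspace holds on the span.\<close>

lemma closed_cspan_minimal: "G \<subseteq> S \<Longrightarrow> closed_csubspace S \<Longrightarrow> closed_cspan G \<subseteq> S"
  unfolding closed_cspan_def by (rule hull_minimal)

lemma closed_cspan_mono: "G \<subseteq> G' \<Longrightarrow> closed_cspan G \<subseteq> closed_cspan G'"
  unfolding closed_cspan_def by (rule hull_mono)

lemma closed_cspan_orthogonal:
  assumes "x \<in> closed_cspan G" "\<And>g. g \<in> G \<Longrightarrow> cinner g y = 0"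
  shows "cinner x y = 0"
  using closed_cspan_minimal[OF _ closed_csubspace_orthogonal, of G y] assms by blast

lemma closed_cspan_orthogonal2:
  assumes "x \<in> closed_cspan G" "y \<in> closed_cspan G'"
    and "\<And>g g'. g \<in> G \<Longrightarrow> g' \<in> G' \<Longrightarrow> cinner g g' = 0"
  shows "cinner x y = 0"
proof (rule closed_cspan_orthogonal[OF assms(1)])
  fix g
  assume "g \<in> G"
  then have "cinner y g = 0"
    using assms(3) by (intro closed_cspan_orthogonal[OF assms(2)]) (subst cinner_eq_zero_commute, simp)
  then show "cinner g y = 0"
    by (subst cinner_eq_zero_commute)
qed

section \<open>Linear isometries and their extension\<close>

lemma linear_isometry_onD:
  assumes "linear_isometry_on S T f"
  shows "x \<in> S \<Longrightarrow> f x \<in> T"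
    and "x \<in> S \<Longrightarrow> y \<in> S \<Longrightarrow> f (x + y) = f x + f y"
    and "x \<in> S \<Longrightarrow> f (c *\<^sub>C x) = c *\<^sub>C f x"
    and "x \<in> S \<Longrightarrow> norm (f x) = norm x"
  using assms by (auto simp: linear_isometry_on_def)

context
  fixes S T f
  assumes li: "linear_isometry_on S T f" and S: "csubspace S"
begin

lemma linear_isometry_on_diff:
  assumes "x \<in> S" "y \<in> S"
  shows "f (x - y) = f x - f y"
  using linear_isometry_onD(2)[OF li csubspace_diff[OF S assms] assms(2)] by simp

lemma linear_isometry_on_dist: "x \<in> S \<Longrightarrow> y \<in> S \<Longrightarrow> dist (f x) (f y) = dist x y"
  by (simp add: dist_norm linear_isometry_onD(4)[OF li] csubspace_diff[OF S]
      flip: linear_isometry_on_diff)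

lemma linear_isometry_on_inj: "inj_on f S"
  using linear_isometry_on_dist by (intro inj_onI) (metis dist_eq_0_iff)

lemma linear_isometry_on_continuous: "continuous_on S f"
  unfolding continuous_on_iff using linear_isometry_on_dist by metis

text \<open>Polarization: norms determine real parts, and replacing \<open>y\<close> by
  \<open>\<i> *\<^sub>C y\<close> yields imaginary parts.\<close>

lemma linear_isometry_on_cinner:
  assumes x: "x \<in> S" and y: "y \<in> S"
  shows "cinner (f x) (f y) = cinner x y"
proof -
  have Re: "Re (cinner (f x) (f z)) = Re (cinner x z)" if z: "z \<in> S" for z
  proof -
    have "norm (f x + f z) = norm (x + z)"
      using S x z linear_isometry_onD(2,4)[OF li] by (metis csubspace_def)
    then show ?thesis
      using norm_add_square[of x z] norm_add_square[of "f x" "f z"] linear_isometry_onD(4)[OF li] x z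
      by simp
  qed
  have "Re (cinner (f x) (f (\<i> *\<^sub>C y))) = Re (cinner x (\<i> *\<^sub>C y))"
    using S y by (intro Re) (auto simp: csubspace_def)
  then have "Im (cinner (f x) (f y)) = Im (cinner x y)"
    by (simp add: linear_isometry_onD(3)[OF li y] cinner_scaleC_right)
  then show ?thesis
    using Re[OF y] by (simp add: complex_eq_iff)
qed

lemma csubspace_linear_isometry_image: "csubspace (f ` S)"
  unfolding csubspace_def
proof (intro conjI ballI allI)
  show "0 \<in> f ` S"
    using linear_isometry_on_diff[of 0 0] S by (auto simp: csubspace_def image_iff)
next
  fix x y
  assume "x \<in> f ` S" "y \<in> f ` S"
  then show "x + y \<in> f ` S"
    using S linear_isometry_onD(2)[OF li, symmetric] by (auto simp: csubspace_def)
next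
  fix c x
  assume "x \<in> f ` S"
  then show "c *\<^sub>C x \<in> f ` S"
    using S linear_isometry_onD(3)[OF li, symmetric] by (auto simp: csubspace_def)
qed

end

lemma linear_isometry_on_comp:
  "linear_isometry_on S T f \<Longrightarrow> linear_isometry_on T R g \<Longrightarrow> linear_isometry_on S R (g \<circ> f)"
  by (auto simp: linear_isometry_on_def image_subset_iff)

lemma linear_isometry_on_subset:
  "linear_isometry_on S T f \<Longrightarrow> S' \<subseteq> S \<Longrightarrow> f ` S' \<subseteq> T' \<Longrightarrow> linear_isometry_on S' T' f"
  by (auto simp: linear_isometry_on_def subset_iff)

text \<open>Preimages of a convergent sequence are Cauchy because distances are preserved, and their
  limit maps to the given one.\<close>

lemma closed_csubspace_linear_isometry_image:
  assumes li: "linear_isometry_on S T f" and S: "closed_csubspace S"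
  shows "closed_csubspace (f ` S)"
proof -
  have sub: "csubspace S"
    using S by (simp add: closed_csubspace_def)
  have "closed (f ` S)"
    unfolding closed_sequential_limits
  proof (intro allI impI, elim conjE)
    fix y l
    assume y: "\<forall>n. y n \<in> f ` S" and l: "y \<longlonglongrightarrow> l"
    then have "\<forall>n. \<exists>x. x \<in> S \<and> y n = f x"
      by blast
    then obtain x where x: "\<And>n. x n \<in> S" "\<And>n. y n = f (x n)"
      by metis
    have "Cauchy x"
      using LIMSEQ_imp_Cauchy[OF l] linear_isometry_on_dist[OF li sub] x by (simp add: Cauchy_def)
    then obtain z where z: "x \<longlonglongrightarrow> z"
      using Cauchy_convergent_iff convergent_def by blast
    have "z \<in> S"
      using closed_sequentially[OF closed_csubspace_closed[OF S] x(1) z] .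
    moreover have "y \<longlonglongrightarrow> f z"
      using continuous_on_tendsto_compose[OF linear_isometry_on_continuous[OF li sub] z] \<open>z \<in> S\<close> x(1)
      by (simp flip: x(2))
    ultimately show "l \<in> f ` S"
      using l LIMSEQ_unique by blast
  qed
  then show ?thesis
    using csubspace_linear_isometry_image[OF li sub] by (simp add: closed_csubspace_def)
qed

lemma closed_csubspace_vimage:
  assumes li: "linear_isometry_on S T f" and S: "closed_csubspace S" and W: "closed_csubspace W"
  shows "closed_csubspace {x \<in> S. f x \<in> W}"
proof -
  have sub: "csubspace S"
    using S by (simp add: closed_csubspace_def)
  have "closed (S \<inter> f -` W)"
    using linear_isometry_on_continuous[OF li sub] S W
    by (intro continuous_closed_preimage) (simp_all add: closed_csubspace_def)
  moreover have "S \<inter> f -` W = {x \<in> S. f x \<in> W}"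
    by auto
  moreover have "f 0 = 0"
    using linear_isometry_on_diff[OF li sub, of 0 0] sub by (simp add: csubspace_def)
  ultimately show ?thesis
    using S W by (simp add: closed_csubspace_def csubspace_def linear_isometry_onD(2,3)[OF li])
qed

lemma closed_csubspace_equalizer:
  assumes f: "linear_isometry_on S T f" and g: "linear_isometry_on S T' g" and S: "closed_csubspace S"
  shows "closed_csubspace {x \<in> S. f x = g x}"
proof -
  have sub: "csubspace S"
    using S by (simp add: closed_csubspace_def)
  have "continuous_on S (\<lambda>x. f x - g x)"
    using linear_isometry_on_continuous[OF f sub] linear_isometry_on_continuous[OF g sub]
    by (intro continuous_intros)
  then have "closed (S \<inter> (\<lambda>x. f x - g x) -` {0})"
    using S by (intro continuous_closed_preimage) (simp_all add: closed_csubspace_def)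
  moreover have "S \<inter> (\<lambda>x. f x - g x) -` {0} = {x \<in> S. f x = g x}"
    by auto
  moreover have "f 0 = 0" "g 0 = 0"
    using linear_isometry_on_diff[OF f sub, of 0 0] linear_isometry_on_diff[OF g sub, of 0 0] sub
    by (simp_all add: csubspace_def)
  ultimately show ?thesis
    using S by (simp add: closed_csubspace_def csubspace_def linear_isometry_onD(2,3)[OF f]
        linear_isometry_onD(2,3)[OF g])
qed

text \<open>The vectors sent into \<open>W\<close> form a closed subspace, so checking generators
  suffices. The next lemma is the analogue for equations between isometries.\<close>

lemma linear_isometry_on_closed_cspan:
  assumes li: "linear_isometry_on S T f" and S: "closed_csubspace S"
    and G: "G \<subseteq> S" "\<And>g. g \<in> G \<Longrightarrow> f g \<in> W" and W: "closed_csubspace W"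
    and x: "x \<in> closed_cspan G"
  shows "f x \<in> W"
  using closed_cspan_minimal[OF _ closed_csubspace_vimage[OF li S W], of G] G x by auto

lemma linear_isometry_on_eq_closed_cspan:
  assumes f: "linear_isometry_on S T f" and g: "linear_isometry_on S T' g" and S: "closed_csubspace S"
    and G: "G \<subseteq> S" "\<And>x. x \<in> G \<Longrightarrow> f x = g x"
    and x: "x \<in> closed_cspan G"
  shows "f x = g x"
  using closed_cspan_minimal[OF _ closed_csubspace_equalizer[OF f g S], of G] G x by auto

text \<open>The graph of the extension is the closed span of \<open>B\<close> in the product Hilbert space.\<close>

lemma isometric_extension:
  fixes B :: "('a::chilbert_space \<times> 'b::chilbert_space) set"
  assumes gram: "\<And>p q. p \<in> B \<Longrightarrow> q \<in> B \<Longrightarrow> cinner (fst p) (fst q) = cinner (snd p) (snd q)"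
  obtains f where "linear_isometry_on (closed_cspan (fst ` B)) (closed_cspan (snd ` B)) f"
    and "\<And>x y. (x, y) \<in> B \<Longrightarrow> f x = y"
proof -
  define R where "R = closed_cspan B"
  have R: "closed_csubspace R"
    unfolding R_def by (rule closed_csubspace_closed_cspan)
  text \<open>Changing the sign of the second component expresses equality of inner products as
    orthogonality.\<close>
  define flip where "flip = (\<lambda>p :: 'a \<times> 'b. (fst p, - snd p))"
  have flip: "cinner p (flip q) = cinner (fst p) (fst q) - cinner (snd p) (snd q)" for p q
    by (simp add: flip_def cinner_prod_def cinner.minus_right)
  have flip_swap: "cinner p (flip q) = 0 \<longleftrightarrow> cinner q (flip p) = 0" for p q
    using cinner_commute[of "fst p" "fst q"] cinner_commute[of "snd p" "snd q"] by (simp add: flip)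
  \<comment> \<open>Orthogonality extends to the span one argument at a time;
    \<open>flip_swap\<close> exchanges the two arguments.\<close>
  have "cinner p (flip q) = 0" if "p \<in> R" "q \<in> B" for p q
    using gram that(2) by (intro closed_cspan_orthogonal[OF that(1)[unfolded R_def]]) (simp add: flip)
  then have "cinner p (flip q) = 0" if "p \<in> R" "q \<in> R" for p q
    using that(1)
    by (subst flip_swap, intro closed_cspan_orthogonal[OF that(2)[unfolded R_def]])
      (subst flip_swap, simp)
  then have "cinner (fst p) (fst p) = cinner (snd p) (snd p)" if "p \<in> R" for p
    using that by (simp add: flip)
  then have iso: "norm (fst p) = norm (snd p)" if "p \<in> R" for p
    using that unfolding cinner_self of_real_eq_iff by (simp add: power2_eq_iff_nonneg)
  have diffR: "p - q \<in> R" if "p \<in> R" "q \<in> R" for p q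
    using closed_csubspace_diff[OF R that] .
  \<comment> \<open>The difference of the two pairs is \<open>(0, y - y')\<close>, and its
    components have equal norm.\<close>
  have unique: "y = y'" if "(x, y) \<in> R" "(x, y') \<in> R" for x y y'
    using iso[OF diffR[OF that]] by simp
  define f where "f x = (THE y. (x, y) \<in> R)" for x
  have f: "f x = y" if "(x, y) \<in> R" for x y
    unfolding f_def using that unique by (intro the_equality)
  \<comment> \<open>A projection of a closed set need not be closed; here \<open>iso\<close> makes
    the second components of a convergent sequence Cauchy.\<close>
  have "closed (fst ` R)"
    unfolding closed_sequential_limits
  proof (intro allI impI, elim conjE)
    fix x l
    assume x: "\<forall>n. x n \<in> fst ` R" and l: "x \<longlonglongrightarrow> l"
    then have "\<forall>n. \<exists>p. p \<in> R \<and> x n = fst p"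
      by blast
    then obtain p where p: "\<And>n. p n \<in> R" "\<And>n. x n = fst (p n)"
      by metis
    have "norm (snd (p m) - snd (p n)) = norm (x m - x n)" for m n
      using iso[OF diffR[OF p(1) p(1)], of m n] p(2) by simp
    then have "Cauchy (\<lambda>n. snd (p n))"
      using LIMSEQ_imp_Cauchy[OF l] by (simp add: Cauchy_def dist_norm)
    then obtain z where z: "(\<lambda>n. snd (p n)) \<longlonglongrightarrow> z"
      using Cauchy_convergent_iff convergent_def by blast
    have "(\<lambda>n. (x n, snd (p n))) \<longlonglongrightarrow> (l, z)"
      using l z by (rule tendsto_Pair)
    then have "p \<longlonglongrightarrow> (l, z)"
      by (simp add: p(2))
    then have "(l, z) \<in> R"
      using closed_sequentially[OF closed_csubspace_closed[OF R], of p] p(1) by blast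
    then show "l \<in> fst ` R"
      by force
  qed
  moreover have "csubspace (fst ` R)"
    using closed_csubspace_0[OF R] closed_csubspace_add[OF R] closed_csubspace_scaleC[OF R]
    unfolding csubspace_def scaleC_prod_def
    by (safe; force intro: rev_image_eqI)
  moreover have "fst ` B \<subseteq> fst ` R"
    unfolding R_def by (intro image_mono closed_cspan_superset)
  ultimately have dom: "closed_cspan (fst ` B) \<subseteq> fst ` R"
    by (intro closed_cspan_minimal) (simp_all add: closed_csubspace_def)
  have graph: "(x, f x) \<in> R" if "x \<in> closed_cspan (fst ` B)" for x
    using dom that f by force
  have ran: "snd p \<in> closed_cspan (snd ` B)" if "p \<in> R" for p
  proof -
    have "closed (snd -` closed_cspan (snd ` B) :: ('a \<times> 'b) set)"
      using closed_csubspace_closed_cspan[of "snd ` B"]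
      by (intro closed_vimage_snd) (simp add: closed_csubspace_def)
    then have "closed_csubspace (snd -` closed_cspan (snd ` B) :: ('a \<times> 'b) set)"
      using closed_csubspace_closed_cspan[of "snd ` B"]
      by (simp add: closed_csubspace_def csubspace_def scaleC_prod_def)
    moreover have "B \<subseteq> snd -` closed_cspan (snd ` B)"
      using closed_cspan_superset[of "snd ` B"] by auto
    ultimately show ?thesis
      using that closed_cspan_minimal unfolding R_def by blast
  qed
  have "linear_isometry_on (closed_cspan (fst ` B)) (closed_cspan (snd ` B)) f"
    unfolding linear_isometry_on_def
  proof (intro conjI ballI allI)
    show "f ` closed_cspan (fst ` B) \<subseteq> closed_cspan (snd ` B)"
      using graph ran by fastforce
    show "f (x + y) = f x + f y" if "x \<in> closed_cspan (fst ` B)" "y \<in> closed_cspan (fst ` B)" for x y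
      using closed_csubspace_add[OF R graph[OF that(1)] graph[OF that(2)]] by (simp add: f)
    show "f (c *\<^sub>C x) = c *\<^sub>C f x" if "x \<in> closed_cspan (fst ` B)" for c x
      using closed_csubspace_scaleC[OF R graph[OF that], of c] by (simp add: f scaleC_prod_def)
    show "norm (f x) = norm x" if "x \<in> closed_cspan (fst ` B)" for x
      using iso[OF graph[OF that]] by simp
  qed
  moreover have "f x = y" if "(x, y) \<in> B" for x y
    using f closed_cspan_base[OF that] by (simp add: R_def)
  ultimately show thesis
    by (rule that)
qed


section \<open>Labels\<close>

lemma shifted_level_le_iff: "finite A \<Longrightarrow> shifted_level A \<le> n \<longleftrightarrow> A \<subseteq> {..<n}"
  by (auto simp: shifted_level_def Suc_le_eq subset_iff)

lemma subset_shifted_level: "finite A \<Longrightarrow> A \<subseteq> {..<shifted_level A}"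
  using shifted_level_le_iff[of A "shifted_level A"] by simp

lemma shifted_level_lessThan: "shifted_level {..<r} = r"
proof (rule order_antisym)
  show "shifted_level {..<r} \<le> r"
    by (simp add: shifted_level_le_iff)
  have "{..<r} \<subseteq> {..<shifted_level {..<r}}"
    by (rule subset_shifted_level) simp
  then show "r \<le> shifted_level {..<r}"
    by (simp only: lessThan_subset_iff)
qed

text \<open>On characteristic functions this inserts a zero at position \<open>i\<close>.\<close>

definition raise :: "nat \<Rightarrow> nat set \<Rightarrow> nat set"
  where "raise i A = (\<lambda>j. if j < i then j else Suc j) ` A"

lemma raise_iff:
  "j \<in> raise i A \<longleftrightarrow> (if j < i then j \<in> A else j \<noteq> i \<and> j - 1 \<in> A)"
  by (cases j) (auto simp: raise_def image_iff split: if_splits intro: bexI[of _ "j - 1"])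

lemma not_in_raise: "i \<notin> raise i A"
  by (simp add: raise_iff)

lemma finite_raise: "finite A \<Longrightarrow> finite (raise i A)"
  by (simp add: raise_def)

lemma card_raise: "card (raise i A) = card A"
  unfolding raise_def by (rule card_image) (auto simp: inj_on_def split: if_splits)

lemma raise_subset: "A \<subseteq> {..<n} \<Longrightarrow> raise i A \<subseteq> {..<Suc n}"
  by (auto simp: raise_def)

text \<open>A zero at position \<open>i\<close> can be deleted again by lowering all larger
  elements.\<close>

lemma ex_raise:
  assumes "i \<notin> A" "finite A"
  obtains B where "finite B" "A = raise i B"
proof
  show "finite ((\<lambda>j. if j < i then j else j - 1) ` A)"
    using assms by simp
  have "raise i ((\<lambda>j. if j < i then j else j - 1) ` A) =
      (\<lambda>a. if (if a < i then a else a - 1) < i then if a < i then a else a - 1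
        else Suc (if a < i then a else a - 1)) ` A"
    by (simp only: raise_def image_image)
  also have "\<dots> = (\<lambda>a. a) ` A"
  proof (rule image_cong)
    fix a
    assume "a \<in> A"
    then have "a \<noteq> i"
      using assms(1) by blast
    then show "(if (if a < i then a else a - 1) < i then if a < i then a else a - 1
        else Suc (if a < i then a else a - 1)) = a"
      by auto
  qed simp
  finally show "A = raise i ((\<lambda>j. if j < i then j else j - 1) ` A)"
    by simp
qed

lemma raise_subset_lessThan:
  assumes "raise i B \<subseteq> {..<Suc n}" "i \<le> n"
  shows "B \<subseteq> {..<n}"
proof
  fix j
  assume "j \<in> B"
  then have "(if j < i then j else Suc j) \<in> raise i B"
    by (simp add: raise_def)
  then show "j \<in> {..<n}"
    using assms by (auto split: if_splits)
qed


section \<open>Towers with partial shifts\<close>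

text \<open>The SCH after its embedding: \<open>T n\<close> plays the role of the image of
  \<open>H n\<close>, and the cofaces have become restrictions of operators defined on all of
  \<open>M\<close>, so compositions no longer carry a level.\<close>

locale shift_tower =
  fixes M :: "'b::chilbert_space set" and T :: "nat \<Rightarrow> 'b set" and \<alpha> :: "nat \<Rightarrow> 'b \<Rightarrow> 'b"
  assumes T: "closed_csubspace (T n)"
    and T_Suc: "T n \<subseteq> T (Suc n)"
    and M_eq: "M = closed_cspan (\<Union>n. T n)"
    and shift: "linear_isometry_on M M (\<alpha> n)"
    and shift_T: "n \<le> k \<Longrightarrow> x \<in> T k \<Longrightarrow> \<alpha> n x \<in> T (Suc k)"
    and shift_fixed: "x \<in> T n \<Longrightarrow> \<alpha> n x = x"
    and shift_shift_T: "i < j \<Longrightarrow> j \<le> Suc k \<Longrightarrow> x \<in> T k \<Longrightarrow> \<alpha> j (\<alpha> i x) = \<alpha> i (\<alpha> (j - 1) x)"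
begin

lemma M: "closed_csubspace M"
  unfolding M_eq by (rule closed_csubspace_closed_cspan)

lemma T_mono: "m \<le> n \<Longrightarrow> T m \<subseteq> T n"
  by (induction n rule: dec_induct) (use T_Suc in auto)

lemma T_subset_M: "T n \<subseteq> M"
  unfolding M_eq by (rule order_trans[OF _ closed_cspan_superset]) auto

lemma T_M: "x \<in> T n \<Longrightarrow> x \<in> M"
  using T_subset_M by blast

lemma shift_M: "x \<in> M \<Longrightarrow> \<alpha> n x \<in> M"
  by (rule linear_isometry_onD(1)[OF shift])

lemma shift_cinner: "x \<in> M \<Longrightarrow> y \<in> M \<Longrightarrow> cinner (\<alpha> n x) (\<alpha> n y) = cinner x y"
  using linear_isometry_on_cinner[OF shift] M by (simp add: closed_csubspace_def)

lemma shift_diff: "x \<in> M \<Longrightarrow> y \<in> M \<Longrightarrow> \<alpha> n (x - y) = \<alpha> n x - \<alpha> n y"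
  using linear_isometry_on_diff[OF shift] M by (simp add: closed_csubspace_def)

lemma shift_on_T: "linear_isometry_on (T n) M (\<alpha> k)"
  by (rule linear_isometry_on_subset[OF shift]) (use T_M shift_M in auto)

text \<open>Every tower vector also lies at a level where the bound on \<open>j\<close> holds, and
  these vectors span \<open>M\<close>.\<close>

lemma shift_shift:
  assumes ij: "i < j" and x: "x \<in> M"
  shows "\<alpha> j (\<alpha> i x) = \<alpha> i (\<alpha> (j - 1) x)"
proof -
  have "(\<alpha> j \<circ> \<alpha> i) x = (\<alpha> i \<circ> \<alpha> (j - 1)) x"
  proof (rule linear_isometry_on_eq_closed_cspan[OF linear_isometry_on_comp[OF shift shift]
        linear_isometry_on_comp[OF shift shift] M])
    show "x \<in> closed_cspan (\<Union>n. T n)"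
      using x by (simp add: M_eq)
    show "(\<Union>n. T n) \<subseteq> M"
      using T_M by blast
    show "(\<alpha> j \<circ> \<alpha> i) y = (\<alpha> i \<circ> \<alpha> (j - 1)) y" if "y \<in> (\<Union>n. T n)" for y
    proof -
      from that obtain n where "y \<in> T n"
        by blast
      then have "y \<in> T (max n j)"
        using T_mono[of n "max n j"] by auto
      then show ?thesis
        using shift_shift_T[OF ij, of "max n j" y] by simp
    qed
  qed
  then show ?thesis
    by simp
qed

text \<open>Orthogonality to the full range of \<open>\<alpha> i\<close>, a condition free of
  levels, in contrast to normality.\<close>

definition perp :: "nat \<Rightarrow> 'b \<Rightarrow> bool"
  where "perp i z \<longleftrightarrow> (\<forall>y\<in>M. cinner z (\<alpha> i y) = 0)"

lemma perpI:
  assumes "\<And>k y. k \<ge> K \<Longrightarrow> y \<in> T k \<Longrightarrow> cinner z (\<alpha> i y) = 0"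
  shows "perp i z"
proof -
  have "\<alpha> i y \<in> {w. cinner w z = 0}" if "y \<in> M" for y
  proof (rule linear_isometry_on_closed_cspan[OF shift M])
    show "y \<in> closed_cspan (\<Union>n. T n)"
      using that by (simp add: M_eq)
    show "closed_csubspace {w. cinner w z = 0}"
      by (rule closed_csubspace_orthogonal)
    show "(\<Union>n. T n) \<subseteq> M"
      using T_M by blast
    fix g
    assume "g \<in> (\<Union>n. T n)"
    then obtain n where "g \<in> T n"
      by blast
    then have "g \<in> T (max n K)"
      using T_mono[of n "max n K"] by auto
    then have "cinner z (\<alpha> i g) = 0"
      using assms[of "max n K" g] by simp
    then show "\<alpha> i g \<in> {w. cinner w z = 0}"
      by (simp add: cinner_eq_zero_commute)
  qed
  then show ?thesis
    by (auto simp: perp_def cinner_eq_zero_commute)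
qed

text \<open>For \<open>r = 0\<close> the conditions are empty and the truncated \<open>r - 1\<close>
  does no harm: \<open>root_space 0 = T 0\<close>.\<close>

definition root_space :: "nat \<Rightarrow> 'b set"
  where "root_space r = {x \<in> T r. \<forall>i<r. \<forall>y\<in>T (r - 1). cinner x (\<alpha> i y) = 0}"

lemma root_space_T: "x \<in> root_space r \<Longrightarrow> x \<in> T r"
  and root_space_M: "x \<in> root_space r \<Longrightarrow> x \<in> M"
  using T_M by (auto simp: root_space_def)

text \<open>Recursion over all positions, rather than over the list of gaps, allows \<open>A\<close>
  and \<open>raise i A\<close> to be compared position by position.\<close>

primrec fill :: "nat set \<Rightarrow> nat \<Rightarrow> 'b \<Rightarrow> 'b"
  where
    "fill A 0 x = x"
  | "fill A (Suc n) x = (if n \<in> A then fill A n x else \<alpha> n (fill A n x))"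

text \<open>The partial shifts beyond the level of \<open>A\<close> act trivially, so this is the product of all
  \<open>\<alpha> n\<close> with \<open>n \<notin> A\<close>, in increasing order.\<close>

definition label_map :: "nat set \<Rightarrow> 'b \<Rightarrow> 'b"
  where "label_map A = fill A (shifted_level A)"

definition label_space :: "nat set \<Rightarrow> 'b set"
  where "label_space A = label_map A ` root_space (card A)"

section \<open>Levels, shifts and spans of the labeled subspaces\<close>

lemma fill_linear_isometry: "linear_isometry_on M M (fill A n)"
proof (induction n)
  case 0
  then show ?case
    by (auto simp: linear_isometry_on_def)
next
  case (Suc n)
  have "fill A (Suc n) = (if n \<in> A then fill A n else \<alpha> n \<circ> fill A n)"
    by auto
  then show ?case
    using Suc linear_isometry_on_comp[OF Suc shift] by simp
qed

lemma label_map_linear_isometry: "linear_isometry_on M M (label_map A)"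
  unfolding label_map_def by (rule fill_linear_isometry)

lemma fill_M: "x \<in> M \<Longrightarrow> fill A n x \<in> M"
  by (rule linear_isometry_onD(1)[OF fill_linear_isometry])

lemma label_map_M: "x \<in> M \<Longrightarrow> label_map A x \<in> M"
  by (rule linear_isometry_onD(1)[OF label_map_linear_isometry])

lemma label_map_cinner: "x \<in> M \<Longrightarrow> y \<in> M \<Longrightarrow> cinner (label_map A x) (label_map A y) = cinner x y"
  using linear_isometry_on_cinner[OF label_map_linear_isometry] M by (simp add: closed_csubspace_def)

text \<open>The start is level \<open>card A\<close>, and each position below \<open>n\<close>
  outside \<open>A\<close> raises the level by one. Hence the level exceeds \<open>n\<close> by the
  number of elements of \<open>A\<close> not yet passed.\<close>

lemma fill_T:
  assumes A: "finite A" and x: "x \<in> T (card A)"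
  shows "fill A n x \<in> T (n + card (A \<inter> {n..}))"
proof (induction n)
  case 0
  then show ?case
    using x by simp
next
  case (Suc n)
  show ?case
  proof (cases "n \<in> A")
    case True
    then have "A \<inter> {n..} = insert n (A \<inter> {Suc n..})"
      by (auto simp: Suc_le_eq le_less)
    then have "card (A \<inter> {n..}) = Suc (card (A \<inter> {Suc n..}))"
      using A by simp
    then show ?thesis
      using Suc True by simp
  next
    case False
    then have "A \<inter> {n..} = A \<inter> {Suc n..}"
      by (auto simp: Suc_le_eq le_less)
    then show ?thesis
      using Suc False shift_T[of n "n + card (A \<inter> {n..})"] by simp
  qed
qed

lemma fill_T_level:
  assumes A: "finite A" "A \<subseteq> {..<n}" and x: "x \<in> T (card A)"
  shows "fill A n x \<in> T n"
proof -
  have "A \<inter> {n..} = {}"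
    using A by auto
  then show ?thesis
    using fill_T[OF A(1) x, of n] by simp
qed

lemma fill_eq_label_map:
  assumes A: "finite A" "A \<subseteq> {..<n}" and x: "x \<in> T (card A)"
  shows "fill A n x = label_map A x"
proof -
  have "shifted_level A \<le> n"
    using A by (simp add: shifted_level_le_iff)
  then show ?thesis
  proof (induction n rule: dec_induct)
    case base
    then show ?case
      by (simp add: label_map_def)
  next
    case (step m)
    then have "A \<subseteq> {..<m}"
      using A(1) by (simp flip: shifted_level_le_iff)
    then have "fill A m x \<in> T m" "m \<notin> A"
      using fill_T_level[OF A(1) _ x] by auto
    then show ?case
      using step by (simp add: shift_fixed)
  qed
qed

lemma label_map_T:
  assumes "finite A" "A \<subseteq> {..<n}" "x \<in> T (card A)"
  shows "label_map A x \<in> T n"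
  using fill_T_level[OF assms] fill_eq_label_map[OF assms] by simp

lemma label_space_T: "finite A \<Longrightarrow> A \<subseteq> {..<n} \<Longrightarrow> label_space A \<subseteq> T n"
  using label_map_T root_space_T by (auto simp: label_space_def)

lemma label_space_M: "label_space A \<subseteq> M"
  using label_map_M root_space_M by (auto simp: label_space_def)

lemma label_map_lessThan: "label_map {..<r} x = x"
proof -
  have "fill {..<r} n x = x" if "n \<le> r" for n
    using that by (induction n) auto
  then show ?thesis
    by (simp add: label_map_def shifted_level_lessThan)
qed

text \<open>The cosimplicial relation moves \<open>\<alpha> i\<close> to the right through the
  product: each factor \<open>\<alpha> n\<close> with \<open>n \<ge> i\<close> becomes
  \<open>\<alpha> (Suc n)\<close>, factors below \<open>i\<close> stay, and
  \<open>\<alpha> i\<close> itself fills the new gap at \<open>i\<close>.\<close>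

lemma shift_label_map:
  assumes A: "finite A" and x: "x \<in> T (card A)"
  shows "\<alpha> i (label_map A x) = label_map (raise i A) x"
proof -
  have low: "fill (raise i A) n x = fill A n x" if "n \<le> i" for n
    using that by (induction n) (auto simp: raise_iff)
  have step: "fill (raise i A) (Suc n) x = \<alpha> i (fill A n x)" if "i \<le> n" for n
    using that
  proof (induction n rule: dec_induct)
    case base
    then show ?case
      using low[of i] by (simp add: not_in_raise)
  next
    case (step n)
    then have "Suc n \<in> raise i A \<longleftrightarrow> n \<in> A"
      by (auto simp: raise_iff)
    moreover have "\<alpha> (Suc n) (\<alpha> i (fill A n x)) = \<alpha> i (\<alpha> n (fill A n x))"
      using step shift_shift[of i "Suc n" "fill A n x"] fill_M[OF T_M[OF x]] by simp
    ultimately show ?case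
      using step by (simp only: fill.simps if_distrib split: if_split) auto
  qed
  define n where "n = max i (shifted_level A)"
  have n: "A \<subseteq> {..<n}"
    using A shifted_level_le_iff[of A n] by (simp add: n_def)
  have "fill A n x = label_map A x"
    using fill_eq_label_map[OF A n x] .
  moreover have "fill (raise i A) (Suc n) x = label_map (raise i A) x"
    using A x n by (intro fill_eq_label_map finite_raise raise_subset) (simp_all add: card_raise)
  ultimately show ?thesis
    using step[of n] by (simp add: n_def)
qed

lemma shift_label_space:
  assumes "finite A" "x \<in> label_space A"
  shows "\<alpha> i x \<in> label_space (raise i A)"
  using assms shift_label_map root_space_T by (auto simp: label_space_def card_raise)

lemma T_span: "T n = closed_cspan (\<Union>A\<in>Pow {..<n}. label_space A)"
proof
  show sub: "closed_cspan (\<Union>A\<in>Pow {..<n}. label_space A) \<subseteq> T n" for n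
    using label_space_T[of _ n] by (intro closed_cspan_minimal T) (blast intro: finite_subset)
  show "T n \<subseteq> closed_cspan (\<Union>A\<in>Pow {..<n}. label_space A)"
  proof (induction n)
    case 0
    have "T 0 \<subseteq> label_space {..<0}"
      unfolding label_space_def by (simp add: label_map_lessThan[of 0, simplified] root_space_def)
    then show ?case
      using closed_cspan_superset by fastforce
  next
    case (Suc n)
    let ?W = "closed_cspan (\<Union>A\<in>Pow {..<Suc n}. label_space A)"
    show ?case
    proof
      fix x
      assume x: "x \<in> T (Suc n)"
      obtain p where p: "p \<in> ?W" "\<And>s. s \<in> ?W \<Longrightarrow> cinner (x - p) s = 0"
        using orthogonal_projection[OF closed_csubspace_closed_cspan
            [of "\<Union>A\<in>Pow {..<Suc n}. label_space A"], where x = x] by blast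
      have "cinner (x - p) (\<alpha> i y) = 0" if i: "i \<le> n" and y: "y \<in> T n" for i y
      proof -
        have "\<alpha> i y \<in> ?W"
        proof (rule linear_isometry_on_closed_cspan[OF shift M])
          show "y \<in> closed_cspan (\<Union>A\<in>Pow {..<n}. label_space A)"
            using y Suc by blast
          show "(\<Union>A\<in>Pow {..<n}. label_space A) \<subseteq> M"
            using label_space_M by blast
          fix g
          assume "g \<in> (\<Union>A\<in>Pow {..<n}. label_space A)"
          then obtain A where A: "A \<subseteq> {..<n}" "g \<in> label_space A"
            by auto
          then have "\<alpha> i g \<in> label_space (raise i A)"
            by (intro shift_label_space) (auto intro: finite_subset)
          then show "\<alpha> i g \<in> ?W"
            using raise_subset[OF A(1), of i] by (intro closed_cspan_base) blast
        qed (rule closed_csubspace_closed_cspan)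
        then show ?thesis
          by (rule p(2))
      qed
      moreover have "x - p \<in> T (Suc n)"
        using x p(1) sub by (intro closed_csubspace_diff T) auto
      ultimately have "x - p \<in> label_space {..<Suc n}"
        unfolding label_space_def by (simp add: label_map_lessThan root_space_def less_Suc_eq_le)
      then have "x - p \<in> ?W"
        by (intro closed_cspan_base) blast
      then have "cinner (x - p) (x - p) = 0"
        by (rule p(2))
      then show "x \<in> ?W"
        using p(1) by simp
    qed
  qed
qed

lemma M_span: "M = closed_cspan (\<Union>A\<in>{A. finite A}. label_space A)"
proof
  have "Pow {..<n} \<subseteq> {A. finite A}" for n :: nat
    using finite_subset[OF _ finite_lessThan] by blast
  then have "T n \<subseteq> closed_cspan (\<Union>A\<in>{A. finite A}. label_space A)" for n
    by (subst T_span) (rule closed_cspan_mono[OF UN_mono[OF _ order_refl]])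
  then show "M \<subseteq> closed_cspan (\<Union>A\<in>{A. finite A}. label_space A)"
    unfolding M_eq by (intro closed_cspan_minimal closed_csubspace_closed_cspan UN_least)
  show "closed_cspan (\<Union>A\<in>{A. finite A}. label_space A) \<subseteq> M"
    by (intro closed_cspan_minimal M UN_least label_space_M)
qed


section \<open>Normality and orthogonality of the labeled subspaces\<close>

text \<open>Condition (d) in terms of inner products, so that no adjoint occurs.\<close>

definition normal_tower :: bool
  where "normal_tower \<longleftrightarrow>
    (\<forall>k i j. i < j \<and> j \<le> k + 1 \<and> i \<le> k \<longrightarrow>
      (\<forall>z\<in>T (Suc k). (\<forall>y\<in>T k. cinner z (\<alpha> i y) = 0) \<longrightarrow>
        (\<forall>y\<in>T (Suc k). cinner (\<alpha> j z) (\<alpha> i y) = 0)))"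

definition orthogonal_labels :: bool
  where "orthogonal_labels \<longleftrightarrow>
    (\<forall>A B. finite A \<and> finite B \<and> A \<noteq> B \<longrightarrow> orthogonal_sets (label_space A) (label_space B))"

context
  assumes normal: normal_tower
begin

lemma normalD:
  assumes "i < j" "j \<le> Suc k" "z \<in> T (Suc k)" "\<And>y. y \<in> T k \<Longrightarrow> cinner z (\<alpha> i y) = 0" "y \<in> T (Suc k)"
  shows "cinner (\<alpha> j z) (\<alpha> i y) = 0"
proof -
  have "j \<le> k + 1" "i \<le> k"
    using assms(1,2) by auto
  then show ?thesis
    using normal assms unfolding normal_tower_def by blast
qed

text \<open>Normality with the top index \<open>j = m + 1\<close> says something about
  \<open>z\<close> itself, because \<open>\<alpha> (Suc m)\<close> fixes it. So orthogonality climbs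
  from each level to the next.\<close>

lemma normal_perp:
  assumes z: "z \<in> T (Suc k)" and i: "i \<le> k" and y: "\<And>y. y \<in> T k \<Longrightarrow> cinner z (\<alpha> i y) = 0"
  shows "perp i z"
proof (rule perpI[of k])
  fix m y
  assume "k \<le> m" "y \<in> T m"
  then show "cinner z (\<alpha> i y) = 0"
  proof (induction m arbitrary: y rule: dec_induct)
    case (step m)
    have zm: "z \<in> T (Suc m)"
      using z T_mono[of "Suc k" "Suc m"] step by auto
    have "cinner (\<alpha> (Suc m) z) (\<alpha> i y) = 0"
      using step i by (intro normalD[of i "Suc m" m] zm) auto
    then show ?case
      by (simp add: shift_fixed[OF zm])
  qed (rule y)
qed

text \<open>Normality at a level high enough for both \<open>z\<close> and \<open>j\<close>,
  followed by the climb of \<open>normal_perp\<close>.\<close>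

lemma perp_shift_above:
  assumes z: "z \<in> T m" and perp: "perp i z" and ij: "i < j"
  shows "perp i (\<alpha> j z)"
proof -
  define k where "k = max m j"
  have zk: "z \<in> T (Suc k)"
    using z T_mono[of m "Suc k"] by (auto simp: k_def le_SucI)
  show ?thesis
  proof (rule normal_perp[of _ "Suc k"])
    show "\<alpha> j z \<in> T (Suc (Suc k))"
      using zk by (intro shift_T) (simp_all add: k_def)
    show "i \<le> Suc k"
      using ij by (simp add: k_def)
    show "cinner (\<alpha> j z) (\<alpha> i y) = 0" if "y \<in> T (Suc k)" for y
      using perp T_M by (intro normalD[OF ij _ zk _ that]) (auto simp: k_def perp_def)
  qed
qed

lemma perp_shift_below:
  assumes z: "z \<in> T m" and perp: "perp l z" and jl: "j \<le> l"
  shows "perp (Suc l) (\<alpha> j z)"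
proof (rule perpI[of "Suc (max m l)"])
  fix k' y
  assume "Suc (max m l) \<le> k'" and y': "y \<in> T k'"
  then obtain k where k: "k' = Suc k" "m \<le> k" "l \<le> k"
    by (cases k') auto
  have y: "y \<in> T (Suc k)"
    using y' k by simp
  have zk: "z \<in> T (Suc k)"
    using z k T_mono[of m "Suc k"] by auto
  obtain p where p: "p \<in> \<alpha> j ` T k" "\<And>s. s \<in> \<alpha> j ` T k \<Longrightarrow> cinner (y - p) s = 0"
    using orthogonal_projection[OF closed_csubspace_linear_isometry_image[OF shift_on_T[of k j] T],
        where x = y] by blast
  then obtain u where u: "u \<in> T k" "p = \<alpha> j u"
    by blast
  have w: "y - p \<in> T (Suc k)"
    using y u k jl shift_T[of j k u] by (intro closed_csubspace_diff T) auto
  have M: "z \<in> M" "u \<in> M" "y \<in> M" "p \<in> M"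
    using zk y T_M u shift_M by blast+
  have "cinner (\<alpha> (Suc l) (y - p)) (\<alpha> j z) = 0"
    using jl k p(2) zk w by (intro normalD[of j "Suc l" k]) auto
  then have "cinner (\<alpha> j z) (\<alpha> (Suc l) y) = cinner (\<alpha> j z) (\<alpha> (Suc l) p)"
    using M by (subst (asm) cinner_eq_zero_commute) (simp add: shift_diff cinner.diff_right)
  also have "\<dots> = cinner (\<alpha> j z) (\<alpha> j (\<alpha> l u))"
    using shift_shift[of j "Suc l" u] jl M u by simp
  also have "\<dots> = 0"
    using shift_cinner perp M shift_M by (simp add: perp_def)
  finally show "cinner (\<alpha> j z) (\<alpha> (Suc l) y) = 0" .
qed

text \<open>During the filling process the element \<open>i\<close> of \<open>A\<close> moves, starting from its rank in \<open>A\<close>, up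
  to its final position.\<close>

lemma perp_fill:
  assumes A: "finite A" and x: "x \<in> root_space (card A)" and i: "i \<in> A"
  shows "perp (if i < n then i else n + card (A \<inter> {n..<i})) (fill A n x)"
proof (induction n)
  case 0
  \<comment> \<open>The initial position is the rank of \<open>i\<close>, one of the indices tested
    in the definition of the root space.\<close>
  have "card (A \<inter> {0..<i}) < card A"
    using A i by (intro psubset_card_mono) auto
  then show ?case
    using x by (auto simp: root_space_def intro!: normal_perp[of _ "card A - 1"])
next
  case (Suc n)
  have mem: "fill A n x \<in> T (n + card (A \<inter> {n..}))"
    using fill_T[OF A root_space_T[OF x]] .
  \<comment> \<open>An element beyond \<open>n\<close> stands still when \<open>n \<in> A\<close>,
    as the count drops while \<open>n\<close> grows; it moves up by one when
    \<open>\<alpha> n\<close> is applied below it. Later shifts act above its final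
    position.\<close>
  consider "i = n" | "i < n" | "i > n" "n \<in> A" | "i > n" "n \<notin> A"
    by linarith
  then show ?case
  proof cases
    case 1
    then show ?thesis
      using Suc i by simp
  next
    case 2
    then show ?thesis
      using Suc perp_shift_above[OF mem, of i n] by simp
  next
    case 3
    then have "A \<inter> {n..<i} = insert n (A \<inter> {Suc n..<i})"
      by (auto simp: Suc_le_eq le_less)
    then show ?thesis
      using Suc 3 A by simp
  next
    case 4
    then have "A \<inter> {n..<i} = A \<inter> {Suc n..<i}"
      by (auto simp: Suc_le_eq le_less)
    then show ?thesis
      using Suc 4 perp_shift_below[OF mem, of _ n] by simp
  qed
qed

lemma perp_label_space:
  assumes A: "finite A" "i \<in> A" and x: "x \<in> label_space A"
  shows "perp i x"
proof -
  have "i < shifted_level A"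
    using subset_shifted_level[OF A(1)] A(2) by auto
  then show ?thesis
    using x perp_fill[OF A(1) _ A(2), of _ "shifted_level A"]
    by (auto simp: label_space_def label_map_def)
qed

lemma normal_imp_orthogonal_labels: orthogonal_labels
proof -
  have *: "cinner x y = 0"
    if fin: "finite A" "finite B" and i: "i \<in> A" "i \<notin> B" and x: "x \<in> label_space A" and y: "y \<in> label_space B"
    for A B i x y
  proof -
    obtain B' where B': "finite B'" "B = raise i B'"
      using ex_raise[OF i(2) fin(2)] .
    obtain u where u: "u \<in> root_space (card B)" "y = label_map B u"
      using y by (auto simp: label_space_def)
    have "y = \<alpha> i (label_map B' u)"
      using u B' root_space_T by (simp add: shift_label_map card_raise)
    moreover have "label_map B' u \<in> M"
      using u root_space_M label_map_M by blast
    ultimately show ?thesis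
      using perp_label_space[OF fin(1) i(1) x] by (simp add: perp_def)
  qed
  show ?thesis
    unfolding orthogonal_labels_def orthogonal_sets_def
  proof (intro allI impI ballI, elim conjE)
    fix A B x y
    assume "finite A" "finite B" "A \<noteq> B" "x \<in> label_space A" "y \<in> label_space B"
    moreover from \<open>A \<noteq> B\<close> obtain i where "i \<in> A \<and> i \<notin> B \<or> i \<in> B \<and> i \<notin> A"
      by blast
    ultimately show "cinner x y = 0"
      using *[of A B i x y] *[of B A i y x] cinner_eq_zero_commute by blast
  qed
qed

end

lemma orthogonal_labelsD:
  assumes orthogonal_labels "finite A" "finite B" "A \<noteq> B" "x \<in> label_space A" "y \<in> label_space B"
  shows "cinner x y = 0"
  using assms unfolding orthogonal_labels_def orthogonal_sets_def by blast

text \<open>A vector of \<open>T (k + 1)\<close> orthogonal to \<open>\<alpha> i ` T k\<close> lies in the closed span of the labeled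
  subspaces whose label contains \<open>i\<close>, a condition that \<open>\<alpha> j\<close> preserves for \<open>j > i\<close>.\<close>

lemma orthogonal_labels_imp_normal:
  assumes orth: orthogonal_labels
  shows normal_tower
  unfolding normal_tower_def
proof (intro allI impI ballI, elim conjE)
  fix k i j z y
  assume ij: "i < j" "i \<le> k" "j \<le> k + 1" and z: "z \<in> T (Suc k)" and y: "y \<in> T (Suc k)"
    and z_perp: "\<forall>y\<in>T k. cinner z (\<alpha> i y) = 0"
  define G where "G = (\<Union>A\<in>{A. A \<subseteq> {..<Suc k} \<and> i \<in> A}. label_space A)"
  define G' where "G' = (\<Union>B\<in>{B. finite B \<and> i \<notin> B}. label_space B)"
  have G_G': "cinner g g' = 0"
    if "g \<in> (\<Union>A\<in>{A. finite A \<and> i \<in> A}. label_space A)" "g' \<in> G'" for g g'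
    using that orthogonal_labelsD[OF orth] by (auto simp: G'_def)
  have shift_G': "\<alpha> i x \<in> closed_cspan G'" if "x \<in> M" for x
  proof (rule linear_isometry_on_closed_cspan[OF shift M])
    show "x \<in> closed_cspan (\<Union>A\<in>{A. finite A}. label_space A)"
      using that M_span by simp
    show "(\<Union>A\<in>{A. finite A}. label_space A) \<subseteq> M"
      using label_space_M by blast
    fix g
    assume "g \<in> (\<Union>A\<in>{A. finite A}. label_space A)"
    then obtain A where A: "finite A" "g \<in> label_space A"
      by auto
    have "raise i A \<in> {B. finite B \<and> i \<notin> B}"
      using finite_raise[OF A(1)] not_in_raise by simp
    then show "\<alpha> i g \<in> closed_cspan G'"
      using shift_label_space[OF A] unfolding G'_def by (intro closed_cspan_base) blast
  qed (rule closed_csubspace_closed_cspan)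
  obtain p where p: "p \<in> closed_cspan G" "\<And>s. s \<in> closed_cspan G \<Longrightarrow> cinner (z - p) s = 0"
    using orthogonal_projection[OF closed_csubspace_closed_cspan[of G], where x = z] by blast
  have "closed_cspan G \<subseteq> T (Suc k)"
    using label_space_T[of _ "Suc k"] unfolding G_def
    by (intro closed_cspan_minimal T) (blast intro: finite_subset)
  then have "z - p \<in> T (Suc k)"
    using z p(1) by (intro closed_csubspace_diff T) auto
  then have "cinner (z - p) (z - p) = 0"
  proof (subst (asm) T_span, elim closed_cspan_orthogonal)
    fix g
    assume "g \<in> (\<Union>A\<in>Pow {..<Suc k}. label_space A)"
    then obtain A where A: "A \<subseteq> {..<Suc k}" "g \<in> label_space A"
      by blast
    have fin: "finite A"
      using A(1) finite_subset by blast
    show "cinner g (z - p) = 0"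
    proof (cases "i \<in> A")
      case True
      then have "g \<in> closed_cspan G"
        using A by (intro closed_cspan_base) (auto simp: G_def)
      then show ?thesis
        using p(2) cinner_eq_zero_commute by blast
    next
      case False
      then obtain B where B: "finite B" "A = raise i B"
        using ex_raise[OF False fin] by blast
      obtain u where u: "u \<in> root_space (card A)" "g = label_map A u"
        using A by (auto simp: label_space_def)
      have g: "g = \<alpha> i (label_map B u)"
        using u B root_space_T by (simp add: shift_label_map card_raise)
      \<comment> \<open>The hypothesis on \<open>z\<close> reaches only as far as
        \<open>T k\<close>, so deleting the zero must lower the level bound by one.\<close>
      have "B \<subseteq> {..<k}"
        using raise_subset_lessThan A(1) B ij by blast
      then have "label_map B u \<in> T k"
        using B u root_space_T by (intro label_map_T) (simp_all add: card_raise)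
      then have "cinner z g = 0"
        using z_perp g by simp
      moreover have "cinner p g = 0"
      proof (rule closed_cspan_orthogonal[OF p(1)])
        fix h
        assume "h \<in> G"
        then show "cinner h g = 0"
          using A False fin finite_subset[of _ "{..<Suc k}"]
          by (intro G_G') (auto simp: G_def G'_def)
      qed
      ultimately have "cinner (z - p) g = 0"
        by (simp add: cinner.diff_left)
      then show ?thesis
        by (subst cinner_eq_zero_commute)
    qed
  qed
  then have "z \<in> closed_cspan G"
    using p(1) by simp
  have "\<alpha> j z \<in> closed_cspan (\<Union>A\<in>{A. finite A \<and> i \<in> A}. label_space A)"
  proof (rule linear_isometry_on_closed_cspan[OF shift M _ _ _ \<open>z \<in> closed_cspan G\<close>])
    show "G \<subseteq> M"
      using label_space_M by (auto simp: G_def)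
    fix g
    assume "g \<in> G"
    then obtain A where A: "A \<subseteq> {..<Suc k}" "i \<in> A" "g \<in> label_space A"
      by (auto simp: G_def)
    then have "finite (raise j A)" "i \<in> raise j A" "\<alpha> j g \<in> label_space (raise j A)"
      using ij finite_subset[of A "{..<Suc k}"] by (auto simp: finite_raise raise_iff shift_label_space)
    then show "\<alpha> j g \<in> closed_cspan (\<Union>A\<in>{A. finite A \<and> i \<in> A}. label_space A)"
      by (intro closed_cspan_base) blast
  qed (rule closed_csubspace_closed_cspan)
  then show "cinner (\<alpha> j z) (\<alpha> i y) = 0"
    using shift_G'[OF T_M[OF y]] G_G' by (rule closed_cspan_orthogonal2)
qed

end


section \<open>The representation of the infinite symmetric group\<close>

lemma norm_sum_square_orthogonal:
  fixes u :: "nat \<Rightarrow> 'a::chilbert_space"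
  assumes "\<And>i j. i \<noteq> j \<Longrightarrow> cinner (u i) (u j) = 0"
  shows "(norm (\<Sum>i<N. u i))\<^sup>2 = (\<Sum>i<N. (norm (u i))\<^sup>2)"
proof (induction N)
  case (Suc N)
  have "cinner (\<Sum>i<N. u i) (u N) = 0"
    using assms by (simp add: cinner.sum_left)
  then show ?case
    using Suc by (simp add: norm_add_square)
qed simp

text \<open>Pairing \<open>x\<close> with the sum of \<open>N\<close> terms gives
  \<open>N * c\<close>, while the norm of that sum grows only like the square root of
  \<open>N\<close>. So \<open>N\<close> times the square of \<open>cmod c\<close> stays
  bounded.\<close>

lemma constant_cinner_orthogonal_sequence:
  fixes u :: "nat \<Rightarrow> 'a::chilbert_space"
  assumes orth: "\<And>i j. i \<noteq> j \<Longrightarrow> cinner (u i) (u j) = 0"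
    and norm: "\<And>i. norm (u i) = r" and const: "\<And>i. cinner x (u i) = c"
  shows "c = 0"
proof (rule ccontr)
  assume "c \<noteq> 0"
  then have c: "(cmod c)\<^sup>2 > 0"
    by simp
  have bound: "real N * (cmod c)\<^sup>2 \<le> (norm x * r)\<^sup>2" if "N > 0" for N
  proof -
    have "cinner x (\<Sum>i<N. u i) = of_nat N * c"
      by (simp add: cinner.sum_right const)
    then have "real N * cmod c \<le> norm x * norm (\<Sum>i<N. u i)"
      using cinner_Cauchy_Schwarz[of x "\<Sum>i<N. u i"] by (simp add: norm_mult)
    then have "(real N * cmod c)\<^sup>2 \<le> (norm x * norm (\<Sum>i<N. u i))\<^sup>2"
      by (intro power_mono) auto
    also have "\<dots> = (norm x)\<^sup>2 * (real N * r\<^sup>2)"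
      using norm_sum_square_orthogonal[of u N, OF orth] by (simp add: power_mult_distrib norm)
    finally have "real N * (real N * (cmod c)\<^sup>2) \<le> real N * (norm x * r)\<^sup>2"
      by (simp add: power2_eq_square mult_ac)
    then show ?thesis
      using that by simp
  qed
  obtain N where N: "(norm x * r)\<^sup>2 < real N * (cmod c)\<^sup>2"
    using reals_Archimedean3[OF c] by blast
  moreover from N have "N > 0"
    by (cases "N = 0") (auto simp: not_less)
  ultimately show False
    using bound[of N] by simp
qed

text \<open>Factors with index above \<open>n\<close> act first and do nothing, so the sequence is
  eventually constant and the limit becomes a finite product.\<close>

lemma canonical_shift_eq_foldr:
  assumes fixed: "\<And>l. l > n \<Longrightarrow> \<sigma> l x = x" and "i \<le> n"
  shows "canonical_shift \<sigma> i x = foldr \<sigma> [Suc i..<Suc n] x"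
proof -
  have "foldr \<sigma> [Suc i..<Suc m] x = foldr \<sigma> [Suc i..<Suc n] x" if "m \<ge> n" for m
    using that
  proof (induction m rule: dec_induct)
    case (step m)
    then show ?case
      using fixed[of "Suc m"] \<open>i \<le> n\<close> by simp
  qed simp
  then have "(\<lambda>m. foldr \<sigma> [Suc i..<Suc m] x) \<longlonglongrightarrow> foldr \<sigma> [Suc i..<Suc n] x"
    by (intro tendsto_eventually eventually_sequentiallyI[of n])
  then show ?thesis
    unfolding canonical_shift_def by (rule limI)
qed

lemma foldr_fixed: "(\<And>l. l \<in> set ls \<Longrightarrow> \<sigma> l x = x) \<Longrightarrow> foldr \<sigma> ls x = x"
  by (induction ls) auto

lemma foldr_linear_isometry:
  assumes "\<And>l. l \<in> set ls \<Longrightarrow> linear_isometry_on S S (\<sigma> l)"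
  shows "linear_isometry_on S S (foldr \<sigma> ls)"
  using assms
proof (induction ls)
  case Nil
  then show ?case
    by (simp add: linear_isometry_on_def)
next
  case (Cons l ls)
  then have "linear_isometry_on S S (\<sigma> l \<circ> foldr \<sigma> ls)"
    by (intro linear_isometry_on_comp[of S S _ S]) auto
  then show ?case
    by (simp add: comp_def)
qed

text \<open>The equality case of Cauchy-Schwarz, used to recognize fixed vectors from a single inner
  product.\<close>

lemma eq_if_cinner_eq_norm_square:
  assumes "norm x = norm y" "cinner x y = complex_of_real ((norm x)\<^sup>2)"
  shows "y = (x::'a::chilbert_space)"
proof -
  have "(norm (x - y))\<^sup>2 = 0"
    using assms by (simp add: norm_diff_square del: of_real_power)
  then show ?thesis
    by simp
qed

text \<open>On \<open>{..<n}\<close> this cycle agrees with the map behind \<open>raise i\<close>;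
  its closing step from \<open>n\<close> to \<open>i\<close> is invisible there.\<close>

lemma transposition_cycle:
  assumes "i \<le> n"
  shows "foldr symmetric_gen [Suc i..<Suc n] j =
    (if j < i then j else if j < n then Suc j else if j = n then i else j)"
  using assms
proof (induction n arbitrary: j rule: dec_induct)
  case (step n)
  then have "foldr symmetric_gen [Suc i..<Suc (Suc n)] j =
      foldr symmetric_gen [Suc i..<Suc n] (symmetric_gen (Suc n) j)"
    by simp
  also have "\<dots> = (if j < i then j else if j < Suc n then Suc j else if j = Suc n then i else j)"
    unfolding step.IH using step.hyps by (auto simp: symmetric_gen_def Transposition.transpose_def)
  finally show ?case .
qed auto

lemma inj_foldr_symmetric_gen: "inj (foldr symmetric_gen ls)"
proof (induction ls)
  case (Cons l ls)
  then have "inj (symmetric_gen l \<circ> foldr symmetric_gen ls)"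
    by (intro inj_compose Cons.IH) (simp add: symmetric_gen_def)
  then show ?case
    by (simp add: comp_def)
qed (simp add: inj_on_def)

lemma raise_eq_cycle:
  assumes "A \<subseteq> {..<n}" "i \<le> n"
  shows "raise i A = foldr symmetric_gen [Suc i..<Suc n] ` A"
  unfolding raise_def using assms by (intro image_cong) (auto simp: transposition_cycle simp del: upt_Suc)

text \<open>Iterating \<open>raise n\<close> on a label that reaches \<open>n\<close> or beyond
  therefore never repeats a label.\<close>

lemma shifted_level_raise:
  assumes A: "finite A" and n: "\<not> A \<subseteq> {..<n}"
  shows "shifted_level (raise n A) = Suc (shifted_level A)" "\<not> raise n A \<subseteq> {..<n}"
proof -
  obtain a where a: "a \<in> A" "a \<ge> n"
    using n by (meson lessThan_iff not_less subsetI)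
  then have "Suc a \<in> raise n A"
    by (simp add: raise_iff)
  then show "\<not> raise n A \<subseteq> {..<n}"
    using a by auto
  have "Max A \<ge> n"
    using order_trans[OF a(2) Max_ge[OF A a(1)]] .
  moreover have "Max (raise n A) = (if Max A < n then Max A else Suc (Max A))"
    unfolding raise_def using A a by (intro mono_Max_commute[symmetric]) (auto simp: mono_def)
  ultimately show "shifted_level (raise n A) = Suc (shifted_level A)"
    using a \<open>Suc a \<in> raise n A\<close> by (auto simp: shifted_level_def)
qed

context shift_tower
begin

text \<open>The value at \<open>x\<close> of the adjoint of \<open>\<alpha> i\<close>: project
  \<open>x\<close> onto the closed range and pull the projection back.\<close>

lemma shift_adjoint:
  assumes "x \<in> M"
  obtains u where "u \<in> M" "\<And>w. w \<in> M \<Longrightarrow> cinner x (\<alpha> i w) = cinner u w"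
proof -
  obtain p where p: "p \<in> \<alpha> i ` M" "\<And>s. s \<in> \<alpha> i ` M \<Longrightarrow> cinner (x - p) s = 0"
    using orthogonal_projection[OF closed_csubspace_linear_isometry_image[OF shift[of i] M],
        where x = x] by blast
  then obtain u where u: "u \<in> M" "p = \<alpha> i u"
    by blast
  have "cinner x (\<alpha> i w) = cinner u w" if "w \<in> M" for w
  proof -
    have "cinner (x - p) (\<alpha> i w) = 0"
      using that by (intro p(2)) simp
    then show ?thesis
      using u that by (simp add: cinner.diff_left shift_cinner)
  qed
  with u(1) show thesis
    by (rule that)
qed

section \<open>Unitary action of permutations for orthogonal labels\<close>

context
  assumes orth: orthogonal_labels
begin

text \<open>The projection of \<open>x\<close> onto \<open>T n\<close> is fixed by
  \<open>\<alpha> n\<close> too, so it suffices that a fixed vector \<open>z\<close> orthogonal to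
  \<open>T n\<close> vanishes; this is tested on labeled vectors.\<close>

lemma shift_fixed_imp_T:
  assumes x: "x \<in> M" and fixed: "\<alpha> n x = x"
  shows "x \<in> T n"
proof -
  obtain p where p: "p \<in> T n" "\<And>s. s \<in> T n \<Longrightarrow> cinner (x - p) s = 0"
    using orthogonal_projection[OF T[of n], where x = x] by blast
  define z where "z = x - p"
  have zM: "z \<in> M"
    unfolding z_def using x p T_M by (intro closed_csubspace_diff M) auto
  have z: "\<alpha> n z = z"
    unfolding z_def using x p T_M by (simp add: shift_diff fixed shift_fixed)
  have "cinner z z = 0"
  proof (rule closed_cspan_orthogonal)
    show "z \<in> closed_cspan (\<Union>A\<in>{A. finite A}. label_space A)"
      using zM M_span by simp
    fix g
    assume "g \<in> (\<Union>A\<in>{A. finite A}. label_space A)"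
    then obtain A where A: "finite A" "g \<in> label_space A"
      by blast
    have "cinner z g = 0"
    proof (cases "A \<subseteq> {..<n}")
      case True
      then show ?thesis
        using p(2) label_space_T A unfolding z_def by blast
    next
      case False
      \<comment> \<open>The levels of the labels \<open>A' t\<close> increase strictly, so the
        \<open>u t\<close> are orthogonal. Their norms are constant by isometry, and their inner
        products with \<open>z\<close> because \<open>\<alpha> n z = z\<close>.\<close>
      define u where "u t = (\<alpha> n ^^ t) g" for t
      define A' where "A' t = (raise n ^^ t) A" for t
      have A': "finite (A' t) \<and> \<not> A' t \<subseteq> {..<n} \<and> shifted_level (A' t) = shifted_level A + t
          \<and> u t \<in> label_space (A' t)" for t
        by (induction t) (use A False in \<open>auto simp: A'_def u_def finite_raise shifted_level_raise
            shift_label_space\<close>)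
      have uM: "u t \<in> M" for t
        using A' label_space_M by blast
      have "cinner (u s) (u t) = 0" if "s \<noteq> t" for s t
      proof (rule orthogonal_labelsD[OF orth])
        show "A' s \<noteq> A' t"
          using that A'[of s] A'[of t] by auto
      qed (use A' in blast)+
      moreover have "norm (u t) = norm g" for t
      proof (induction t)
        case (Suc t)
        then show ?case
          using linear_isometry_onD(4)[OF shift uM[of t], of n] by (simp add: u_def)
      qed (simp add: u_def)
      moreover have "cinner z (u t) = cinner z g" for t
      proof (induction t)
        case (Suc t)
        then show ?case
          using shift_cinner[OF zM uM[of t], of n] by (simp add: u_def z)
      qed (simp add: u_def)
      ultimately show ?thesis
        by (rule constant_cinner_orthogonal_sequence)
    qed
    then show "cinner g z = 0"
      by (subst cinner_eq_zero_commute)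
  qed
  then show ?thesis
    using p(1) by (simp add: z_def)
qed

text \<open>An injective \<open>p\<close> keeps distinct labels distinct, so both inner products
  vanish for \<open>A \<noteq> A'\<close>. For equal labels both equal \<open>cinner x x'\<close>,
  as label maps are isometries on one root space, chosen by cardinality alone; the order in which
  \<open>p\<close> arranges \<open>A\<close> is irrelevant.\<close>

lemma ex_permutation_action:
  assumes p: "inj p"
  shows "\<exists>f. linear_isometry_on M M f \<and>
    (\<forall>A x. finite A \<longrightarrow> x \<in> root_space (card A) \<longrightarrow> f (label_map A x) = label_map (p ` A) x)"
proof -
  define B where "B = {(label_map A x, label_map (p ` A) x) | A x. finite A \<and> x \<in> root_space (card A)}"
  have card: "card (p ` A) = card A" for A
    using p by (intro card_image) (auto simp: inj_on_def)
  have gram: "cinner (fst b) (fst c) = cinner (snd b) (snd c)" if "b \<in> B" "c \<in> B" for b c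
  proof -
    from that obtain A x A' x' where b: "b = (label_map A x, label_map (p ` A) x)"
        "finite A" "x \<in> root_space (card A)"
      and c: "c = (label_map A' x', label_map (p ` A') x')" "finite A'" "x' \<in> root_space (card A')"
      by (auto simp: B_def)
    show ?thesis
    proof (cases "A = A'")
      case True
      then show ?thesis
        using b c root_space_M by (simp add: label_map_cinner)
    next
      case False
      then have "p ` A \<noteq> p ` A'"
        using p by (simp add: inj_image_eq_iff)
      then have "cinner (label_map (p ` A) x) (label_map (p ` A') x') = 0"
        using b c by (intro orthogonal_labelsD[OF orth, of "p ` A" "p ` A'"])
          (simp_all add: label_space_def card)
      moreover have "cinner (label_map A x) (label_map A' x') = 0"
        using b c False by (intro orthogonal_labelsD[OF orth, of A A']) (simp_all add: label_space_def)
      ultimately show ?thesis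
        using b c by simp
    qed
  qed
  obtain f where f: "linear_isometry_on (closed_cspan (fst ` B)) (closed_cspan (snd ` B)) f"
    "\<And>x y. (x, y) \<in> B \<Longrightarrow> f x = y"
    using isometric_extension[OF gram] by blast
  have "fst ` B = (\<Union>A\<in>{A. finite A}. label_space A)"
    by (force simp: B_def label_space_def)
  then have dom: "closed_cspan (fst ` B) = M"
    using M_span by simp
  have "snd ` B \<subseteq> M"
    using label_map_M root_space_M by (auto simp: B_def)
  then have "closed_cspan (snd ` B) \<subseteq> M"
    by (rule closed_cspan_minimal[OF _ M])
  then have "linear_isometry_on M M f"
    using f(1) unfolding dom by (auto simp: linear_isometry_on_def)
  moreover have "f (label_map A x) = label_map (p ` A) x" if "finite A" "x \<in> root_space (card A)" for A x
    using that by (intro f(2)) (auto simp: B_def)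
  ultimately show ?thesis
    by blast
qed

text \<open>Restriction to \<open>M\<close> gives the extensionality that \<open>Bij M\<close>
  demands and makes multiplicativity an equality of functions.\<close>

definition act :: "(nat \<Rightarrow> nat) \<Rightarrow> 'b \<Rightarrow> 'b"
  where "act p = restrict (SOME f. linear_isometry_on M M f \<and>
    (\<forall>A x. finite A \<longrightarrow> x \<in> root_space (card A) \<longrightarrow> f (label_map A x) = label_map (p ` A) x)) M"

lemma act:
  assumes p: "inj p"
  shows act_linear_isometry: "linear_isometry_on M M (act p)"
    and act_label_map: "finite A \<Longrightarrow> x \<in> root_space (card A) \<Longrightarrow> act p (label_map A x) = label_map (p ` A) x"
proof -
  define f where "f = (SOME f. linear_isometry_on M M f \<and>
    (\<forall>A x. finite A \<longrightarrow> x \<in> root_space (card A) \<longrightarrow> f (label_map A x) = label_map (p ` A) x))"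
  have f: "linear_isometry_on M M f"
    "\<And>A x. finite A \<Longrightarrow> x \<in> root_space (card A) \<Longrightarrow> f (label_map A x) = label_map (p ` A) x"
    using someI_ex[OF ex_permutation_action[OF p]] unfolding f_def by blast+
  have act: "act p = restrict f M"
    by (simp add: act_def f_def)
  show "linear_isometry_on M M (act p)"
    using f(1) closed_csubspace_add[OF M] closed_csubspace_scaleC[OF M]
    by (auto simp: act linear_isometry_on_def image_subset_iff)
  show "act p (label_map A x) = label_map (p ` A) x" if "finite A" "x \<in> root_space (card A)"
    using f(2)[OF that] label_map_M root_space_M that by (simp add: act)
qed

lemma act_M: "inj p \<Longrightarrow> x \<in> M \<Longrightarrow> act p x \<in> M"
  by (rule linear_isometry_onD(1)[OF act_linear_isometry])

lemma eq_on_M: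
  assumes "linear_isometry_on M M f" "linear_isometry_on M M g"
    and "\<And>A x. finite A \<Longrightarrow> x \<in> root_space (card A) \<Longrightarrow> f (label_map A x) = g (label_map A x)"
    and "x \<in> M"
  shows "f x = g x"
proof (rule linear_isometry_on_eq_closed_cspan[OF assms(1,2) M])
  show "x \<in> closed_cspan (\<Union>A\<in>{A. finite A}. label_space A)"
    using \<open>x \<in> M\<close> M_span by simp
  show "(\<Union>A\<in>{A. finite A}. label_space A) \<subseteq> M"
    by (intro UN_least label_space_M)
  show "f y = g y" if "y \<in> (\<Union>A\<in>{A. finite A}. label_space A)" for y
    using that assms(3) by (auto simp: label_space_def)
qed

lemma eq_on_T:
  assumes "linear_isometry_on M M f" "linear_isometry_on M M g"
    and "\<And>A x. A \<subseteq> {..<n} \<Longrightarrow> x \<in> root_space (card A) \<Longrightarrow> f (label_map A x) = g (label_map A x)"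
    and "x \<in> T n"
  shows "f x = g x"
proof (rule linear_isometry_on_eq_closed_cspan[OF assms(1,2) M])
  show "x \<in> closed_cspan (\<Union>A\<in>Pow {..<n}. label_space A)"
    using \<open>x \<in> T n\<close> T_span by simp
  show "(\<Union>A\<in>Pow {..<n}. label_space A) \<subseteq> M"
    by (intro UN_least label_space_M)
  show "f y = g y" if "y \<in> (\<Union>A\<in>Pow {..<n}. label_space A)" for y
    using that assms(3) by (auto simp: label_space_def)
qed

lemma act_act:
  assumes p: "inj p" and q: "inj q" and x: "x \<in> M"
  shows "act p (act q x) = act (p \<circ> q) x"
proof -
  have "(act p \<circ> act q) x = act (p \<circ> q) x"
  proof (rule eq_on_M[OF _ _ _ x])
    fix A :: "nat set" and x
    assume "finite A" "x \<in> root_space (card A)"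
    moreover have "card (q ` A) = card A"
      using q by (intro card_image) (auto simp: inj_on_def)
    ultimately show "(act p \<circ> act q) (label_map A x) = act (p \<circ> q) (label_map A x)"
      using p q by (simp add: act_label_map inj_compose image_comp)
  qed (intro linear_isometry_on_comp[of M M _ M] act_linear_isometry inj_compose p q)+
  then show ?thesis
    by simp
qed

lemma act_id:
  assumes x: "x \<in> M"
  shows "act id x = x"
proof -
  have "act id x = id x"
  proof (rule eq_on_M[OF _ _ _ x])
    show "linear_isometry_on M M id"
      by (simp add: linear_isometry_on_def)
  qed (simp_all add: act_linear_isometry act_label_map)
  then show ?thesis
    by simp
qed

lemma act_unitary:
  assumes p: "bij p"
  shows "act p \<in> carrier (unitary_group M)"
proof -
  have inj: "inj p" "inj (inv_into UNIV p)"
    using p by (simp_all add: bij_is_inj bij_imp_bij_inv)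
  have inv: "inv_into UNIV p \<circ> p = id" "p \<circ> inv_into UNIV p = id"
    using p by (simp_all add: bij_is_inj bij_is_surj flip: surj_iff)
  have "bij_betw (act p) M M"
  proof (rule bij_betw_byWitness)
    show "\<forall>x\<in>M. act (inv_into UNIV p) (act p x) = x" "\<forall>x\<in>M. act p (act (inv_into UNIV p) x) = x"
      using inj inv by (simp_all add: act_act act_id)
  qed (use act_M inj in auto)
  moreover have "act p \<in> extensional M"
    by (simp add: act_def)
  ultimately show ?thesis
    using act_linear_isometry[OF inj(1)] by (simp add: unitary_group_def Bij_def)
qed

lemma act_unitary_rep: "unitary_rep infinite_symmetric_group M act"
  unfolding unitary_rep_def
proof (intro conjI homI)
  show "csubspace M" "closed M"
    using M by (simp_all add: closed_csubspace_def)
next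
  fix p
  assume "p \<in> carrier infinite_symmetric_group"
  then show "act p \<in> carrier (unitary_group M)"
    by (intro act_unitary) (simp add: infinite_symmetric_group_def)
next
  fix p q
  assume "p \<in> carrier infinite_symmetric_group" "q \<in> carrier infinite_symmetric_group"
  then have pq: "bij p" "bij q"
    by (simp_all add: infinite_symmetric_group_def)
  then have "act p \<in> Bij M" "act q \<in> Bij M"
    using act_unitary by (simp_all add: unitary_group_def)
  then have "act p \<otimes>\<^bsub>unitary_group M\<^esub> act q = compose M (act p) (act q)"
    by (simp add: unitary_group_def BijGroup_def)
  also have "\<dots> = act (p \<circ> q)"
  proof
    fix x
    show "compose M (act p) (act q) x = act (p \<circ> q) x"
      using pq by (cases "x \<in> M") (simp_all add: compose_def act_act bij_is_inj, simp add: act_def)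
  qed
  finally show "act (p \<otimes>\<^bsub>infinite_symmetric_group\<^esub> q) = act p \<otimes>\<^bsub>unitary_group M\<^esub> act q"
    by (simp add: infinite_symmetric_group_def)
qed

abbreviation gen :: "nat \<Rightarrow> 'b \<Rightarrow> 'b"
  where "gen m \<equiv> act (symmetric_gen m)"

lemma inj_symmetric_gen: "inj (symmetric_gen m)"
  by (simp add: symmetric_gen_def)

lemma foldr_gen_linear_isometry: "linear_isometry_on M M (foldr gen ls)"
  by (intro foldr_linear_isometry act_linear_isometry inj_symmetric_gen)

lemma foldr_gen_label_map:
  assumes A: "finite A" and x: "x \<in> root_space (card A)"
  shows "foldr gen ls (label_map A x) = label_map (foldr symmetric_gen ls ` A) x"
proof (induction ls)
  case (Cons l ls)
  have "card (foldr symmetric_gen ls ` A) = card A"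
    using inj_foldr_symmetric_gen by (intro card_image) (auto simp: inj_on_def)
  then show ?case
    using Cons A x by (simp add: act_label_map inj_symmetric_gen image_comp comp_def)
qed (simp add: image_def)

text \<open>Both sides permute labels, and on subsets of \<open>{..<n}\<close> the cycle and
  \<open>raise i\<close> agree.\<close>

lemma shift_eq_foldr_gen:
  assumes i: "i \<le> n" and x: "x \<in> T n"
  shows "\<alpha> i x = foldr gen [Suc i..<Suc n] x"
proof (rule eq_on_T[OF shift foldr_gen_linear_isometry _ x])
  fix A x
  assume A: "A \<subseteq> {..<n}" and x: "x \<in> root_space (card A)"
  then have fin: "finite A"
    using finite_subset by blast
  then show "\<alpha> i (label_map A x) = foldr gen [Suc i..<Suc n] (label_map A x)"
    using A i x root_space_T
    by (simp add: foldr_gen_label_map shift_label_map raise_eq_cycle del: upt_Suc)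
qed

lemma gen_fixed:
  assumes l: "l > n" and x: "x \<in> T n"
  shows "gen l x = x"
proof -
  have "gen l x = id x"
  proof (rule eq_on_T[OF _ _ _ x])
    show "linear_isometry_on M M id"
      by (simp add: linear_isometry_on_def)
    show "linear_isometry_on M M (gen l)"
      by (intro act_linear_isometry inj_symmetric_gen)
    fix A x
    assume A: "A \<subseteq> {..<n}" and x: "x \<in> root_space (card A)"
    then have "symmetric_gen l ` A = (\<lambda>j. j) ` A"
      using l by (intro image_cong) (auto simp: symmetric_gen_def Transposition.transpose_def)
    then show "gen l (label_map A x) = id (label_map A x)"
      using x finite_subset[OF A] by (simp add: act_label_map inj_symmetric_gen)
  qed
  then show ?thesis
    by simp
qed

text \<open>A vector \<open>x\<close> fixed by the generators beyond \<open>n\<close> need not be a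
  tower vector, so \<open>\<alpha> n x\<close> has no product formula yet. On a labeled
  \<open>g\<close>, however, \<open>\<alpha> n\<close> is a product of generators that fix
  \<open>x\<close>, whence \<open>cinner x (\<alpha> n g) = cinner x g\<close>. So the adjoint of
  \<open>\<alpha> n\<close> fixes \<open>x\<close>, the equality case gives
  \<open>\<alpha> n x = x\<close>, and \<open>shift_fixed_imp_T\<close> applies.\<close>

lemma canonical_tower_gen: "canonical_tower M gen n = T n"
proof
  show "T n \<subseteq> canonical_tower M gen n"
    using gen_fixed T_M by (auto simp: canonical_tower_def)
  show "canonical_tower M gen n \<subseteq> T n"
  proof
    fix x
    assume "x \<in> canonical_tower M gen n"
    then have x: "x \<in> M" and fixed: "\<And>l. l > n \<Longrightarrow> gen l x = x"
      by (simp_all add: canonical_tower_def)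
    obtain u where u: "u \<in> M" "\<And>w. w \<in> M \<Longrightarrow> cinner x (\<alpha> n w) = cinner u w"
      using shift_adjoint[OF x] by blast
    have "cinner (u - x) (u - x) = 0"
    proof (rule closed_cspan_orthogonal)
      have "u - x \<in> M"
        using u x by (intro closed_csubspace_diff M)
      then show "u - x \<in> closed_cspan (\<Union>A\<in>{A. finite A}. label_space A)"
        using M_span by simp
      fix g
      assume "g \<in> (\<Union>A\<in>{A. finite A}. label_space A)"
      then obtain A where A: "finite A" "g \<in> label_space A"
        by blast
      define m where "m = max n (shifted_level A)"
      have g: "g \<in> T m"
        using label_space_T[OF A(1), of m] A by (auto simp: m_def simp flip: shifted_level_le_iff)
      have gM: "g \<in> M"
        using T_M[OF g] .
      have "cinner u g = cinner x (foldr gen [Suc n..<Suc m] g)"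
        using u(2)[OF gM] shift_eq_foldr_gen[OF _ g, of n] by (simp add: m_def del: upt_Suc)
      also have "\<dots> = cinner (foldr gen [Suc n..<Suc m] x) (foldr gen [Suc n..<Suc m] g)"
        using foldr_fixed[of "[Suc n..<Suc m]" gen x] fixed by (simp del: upt_Suc)
      also have "\<dots> = cinner x g"
        using linear_isometry_on_cinner[OF foldr_gen_linear_isometry _ x gM] M
        by (simp add: closed_csubspace_def del: upt_Suc)
      finally have "cinner (u - x) g = 0"
        by (simp add: cinner.diff_left)
      then show "cinner g (u - x) = 0"
        by (subst cinner_eq_zero_commute)
    qed
    then have "cinner x (\<alpha> n x) = cinner x x"
      using u(2)[OF x] by simp
    then have "\<alpha> n x = x"
      using linear_isometry_onD(4)[OF shift x, of n]
      by (intro eq_if_cinner_eq_norm_square[of x "\<alpha> n x"]) (simp_all only: cinner_self)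
    then show "x \<in> T n"
      by (rule shift_fixed_imp_T[OF x])
  qed
qed

lemma shift_eq_canonical_shift:
  assumes "i \<le> n" "x \<in> T n"
  shows "\<alpha> i x = canonical_shift gen i x"
  using canonical_shift_eq_foldr[of n gen x i] gen_fixed shift_eq_foldr_gen assms
  by (simp del: upt_Suc)

end

end


section \<open>Unitary representations of the infinite braid group\<close>

text \<open>The representation reduced to its generators; surjectivity stands in for the inverse
  letters.\<close>

locale braid_unitaries =
  fixes K :: "'b::chilbert_space set" and \<sigma> :: "nat \<Rightarrow> 'b \<Rightarrow> 'b"
  assumes K: "closed_csubspace K"
    and gen_isometry: "m \<ge> 1 \<Longrightarrow> linear_isometry_on K K (\<sigma> m)"
    and gen_surj: "m \<ge> 1 \<Longrightarrow> \<sigma> m ` K = K"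
    and gen_braid: "m \<ge> 1 \<Longrightarrow> x \<in> K \<Longrightarrow>
      \<sigma> m (\<sigma> (Suc m) (\<sigma> m x)) = \<sigma> (Suc m) (\<sigma> m (\<sigma> (Suc m) x))"
    and gen_commute: "m \<ge> 1 \<Longrightarrow> n \<ge> m + 2 \<Longrightarrow> x \<in> K \<Longrightarrow> \<sigma> m (\<sigma> n x) = \<sigma> n (\<sigma> m x)"
begin

lemma gen_K: "m \<ge> 1 \<Longrightarrow> x \<in> K \<Longrightarrow> \<sigma> m x \<in> K"
  using gen_surj by blast

lemma foldr_isometry: "\<forall>l\<in>set ls. l \<ge> 1 \<Longrightarrow> linear_isometry_on K K (foldr \<sigma> ls)"
  by (rule foldr_linear_isometry) (simp add: gen_isometry)

lemma foldr_K: "\<forall>l\<in>set ls. l \<ge> 1 \<Longrightarrow> x \<in> K \<Longrightarrow> foldr \<sigma> ls x \<in> K"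
  by (rule linear_isometry_onD(1)[OF foldr_isometry])

lemma gen_commute_foldr:
  assumes "m \<ge> 1" "\<forall>l\<in>set ls. l \<ge> 1 \<and> (l \<ge> m + 2 \<or> m \<ge> l + 2)" "x \<in> K"
  shows "\<sigma> m (foldr \<sigma> ls x) = foldr \<sigma> ls (\<sigma> m x)"
  using assms(2)
proof (induction ls)
  case (Cons l ls)
  have "foldr \<sigma> ls x \<in> K"
    using Cons.prems assms(3) by (intro foldr_K) auto
  then have "\<sigma> m (\<sigma> l (foldr \<sigma> ls x)) = \<sigma> l (\<sigma> m (foldr \<sigma> ls x))"
    using Cons.prems assms(1) gen_commute[of m l] gen_commute[of l m] by auto
  then show ?case
    using Cons by simp
qed simp

text \<open>\<open>\<sigma> l\<close> commutes past the factors beyond \<open>l + 1\<close>, the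
  braid relation turns it into \<open>\<sigma> (Suc l)\<close>, and that commutes past the factors
  below \<open>l\<close>.\<close>

lemma foldr_gen:
  assumes l: "Suc i \<le> l" "Suc l \<le> m" and x: "x \<in> K"
  shows "foldr \<sigma> [Suc i..<Suc m] (\<sigma> l x) = \<sigma> (Suc l) (foldr \<sigma> [Suc i..<Suc m] x)"
proof -
  have split: "[Suc i..<Suc m] = [Suc i..<l] @ l # Suc l # [Suc (Suc l)..<Suc m]"
    using l upt_add_eq_append[of "Suc i" l "Suc m - l"] by (simp add: upt_conv_Cons del: upt_Suc)
  define y where "y = foldr \<sigma> [Suc (Suc l)..<Suc m] x"
  have y: "y \<in> K"
    unfolding y_def using x by (intro foldr_K) auto
  have "foldr \<sigma> [Suc i..<Suc m] (\<sigma> l x) = foldr \<sigma> [Suc i..<l] (\<sigma> l (\<sigma> (Suc l) (\<sigma> l y)))"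
    unfolding split y_def using l x by (subst gen_commute_foldr[of l]) (auto simp del: upt_Suc)
  also have "\<dots> = foldr \<sigma> [Suc i..<l] (\<sigma> (Suc l) (\<sigma> l (\<sigma> (Suc l) y)))"
    using l y by (subst gen_braid) auto
  also have "\<dots> = \<sigma> (Suc l) (foldr \<sigma> [Suc i..<l] (\<sigma> l (\<sigma> (Suc l) y)))"
    using l y by (subst gen_commute_foldr[of "Suc l"]) (auto simp: gen_K)
  also have "\<dots> = \<sigma> (Suc l) (foldr \<sigma> [Suc i..<Suc m] x)"
    unfolding split y_def by (simp del: upt_Suc)
  finally show ?thesis .
qed

end

lemma braid_unitaries_rep:
  assumes rep: "unitary_rep braid_group K U"
  shows "braid_unitaries K (\<lambda>m. U (braid_gen m))"
proof -
  define P where "P w = U (braid_class w)" for w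
  have hom: "U \<in> hom braid_group (unitary_group K)" and K: "csubspace K" "closed K"
    using rep by (simp_all add: unitary_rep_def)
  have in_carrier: "braid_class w \<in> carrier braid_group" if "w \<in> braid_words" for w
    using that by (simp add: braid_group_def)
  have P: "P w \<in> Bij K" "linear_isometry_on K K (P w)" if "w \<in> braid_words" for w
    using hom in_carrier[OF that] by (auto simp: P_def hom_def unitary_group_def)
  \<comment> \<open>Products in the unitary group are compositions restricted to \<open>K\<close>,
    hence the condition on \<open>x\<close>.\<close>
  have P_append: "P (u @ w) x = P u (P w x)"
    if "u \<in> braid_words" "w \<in> braid_words" "x \<in> K" for u w x
  proof -
    have "P (u @ w) = P u \<otimes>\<^bsub>unitary_group K\<^esub> P w"
      using hom that in_carrier unfolding P_def hom_def by (simp flip: braid_mult)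
    also have "\<dots> = compose K (P u) (P w)"
      using P that by (simp add: unitary_group_def BijGroup_def)
    finally show ?thesis
      using that by (simp add: compose_def)
  qed
  have word: "[(m, True)] \<in> braid_words" if "m \<ge> 1" for m
    using that by (simp add: braid_words_def)
  have P_K: "P [(m, True)] x \<in> K" if "m \<ge> 1" "x \<in> K" for m x
    using P(2)[OF word[OF that(1)]] that linear_isometry_onD(1) by blast
  have P2: "P [(m, True), (n, True)] x = P [(m, True)] (P [(n, True)] x)"
    if "m \<ge> 1" "n \<ge> 1" "x \<in> K" for m n x
    using P_append[of "[(m, True)]" "[(n, True)]" x] that word by simp
  have P3: "P [(m, True), (n, True), (p, True)] x = P [(m, True)] (P [(n, True)] (P [(p, True)] x))"
    if "m \<ge> 1" "n \<ge> 1" "p \<ge> 1" "x \<in> K" for m n p x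
    using P_append[of "[(m, True), (n, True)]" "[(p, True)]" x] P2[of m n "P [(p, True)] x"] that word P_K
    by (simp add: braid_words_def)
  have eq: "P u = P v" if "u \<in> braid_words" "braid_eq u v" for u v
    using that braid_class_eq_iff[of u v] by (simp add: P_def)
  have "braid_unitaries K (\<lambda>m. P [(m, True)])"
  proof
    show "closed_csubspace K"
      using K by (simp add: closed_csubspace_def)
    show "linear_isometry_on K K (P [(m, True)])" if "1 \<le> m" for m
      by (rule P(2)[OF word[OF that]])
    show "P [(m, True)] ` K = K" if "1 \<le> m" for m
      using P(1)[OF word[OF that]] by (simp add: Bij_def bij_betw_def)
    show "P [(m, True)] (P [(Suc m, True)] (P [(m, True)] x)) =
        P [(Suc m, True)] (P [(m, True)] (P [(Suc m, True)] x))" if "1 \<le> m" "x \<in> K" for m x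
    proof -
      have "P [(m, True), (Suc m, True), (m, True)] = P [(Suc m, True), (m, True), (Suc m, True)]"
        using braid_eq.braid[OF that(1)] that(1) by (intro eq) (simp_all add: braid_words_def)
      then show ?thesis
        using that by (simp flip: P3)
    qed
    show "P [(m, True)] (P [(n, True)] x) = P [(n, True)] (P [(m, True)] x)"
      if "1 \<le> m" "m + 2 \<le> n" "x \<in> K" for m n x
    proof -
      have "P [(m, True), (n, True)] = P [(n, True), (m, True)]"
        using braid_eq.commute[OF that(1,2)] that by (intro eq) (simp_all add: braid_words_def)
      then show ?thesis
        using that by (simp flip: P2)
    qed
  qed
  then show ?thesis
    by (simp add: P_def braid_gen_def)
qed

text \<open>The given tower is itself the canonical one, so membership in \<open>T k\<close> can be
  detected by the generators beyond \<open>k\<close>.\<close>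

locale braided_tower = shift_tower M T \<alpha> + braid_unitaries K \<sigma>
  for M :: "'b::chilbert_space set" and T \<alpha> K \<sigma> +
  assumes T_canonical: "T n = canonical_tower K \<sigma> n"
    and shift_canonical: "i \<le> n \<Longrightarrow> x \<in> T n \<Longrightarrow> \<alpha> i x = canonical_shift \<sigma> i x"
begin

lemma T_iff: "x \<in> T n \<longleftrightarrow> x \<in> K \<and> (\<forall>l>n. \<sigma> l x = x)"
  by (simp add: T_canonical canonical_tower_def)

lemma M_subset_K: "M \<subseteq> K"
  unfolding M_eq using T_iff by (intro closed_cspan_minimal K) blast

lemma gen_fixes_T: "x \<in> T n \<Longrightarrow> l > n \<Longrightarrow> \<sigma> l x = x"
  by (simp add: T_iff)

lemma shift_eq_foldr: "i \<le> n \<Longrightarrow> x \<in> T n \<Longrightarrow> \<alpha> i x = foldr \<sigma> [Suc i..<Suc n] x"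
  using canonical_shift_eq_foldr[of n \<sigma> x i] by (simp add: shift_canonical T_iff del: upt_Suc)

lemma gen_T:
  assumes l: "1 \<le> l" "l < m" and x: "x \<in> T m"
  shows "\<sigma> l x \<in> T m"
  unfolding T_iff
proof (intro conjI allI impI)
  show "\<sigma> l x \<in> K"
    using x l by (simp add: T_iff gen_K)
  fix p
  assume "p > m"
  then show "\<sigma> p (\<sigma> l x) = \<sigma> l x"
    using gen_commute[of l p x] x l by (simp add: T_iff)
qed

text \<open>For \<open>p > m\<close> the generator \<open>\<sigma> p\<close> commutes with
  \<open>\<sigma> l\<close> and fixes \<open>x\<close>, so injectivity of \<open>\<sigma> l\<close>
  makes it fix the preimage \<open>w\<close>.\<close>

lemma gen_T_preimage:
  assumes l: "1 \<le> l" "l < m" and x: "x \<in> T m"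
  obtains w where "w \<in> T m" "\<sigma> l w = x"
proof -
  have "x \<in> \<sigma> l ` K"
    using x l by (simp add: gen_surj T_iff)
  then obtain w where w: "w \<in> K" "\<sigma> l w = x"
    by blast
  have "\<sigma> p w = w" if "p > m" for p
  proof -
    have "\<sigma> l (\<sigma> p w) = \<sigma> l w"
      using gen_commute[of l p w] x l w that by (simp add: T_iff)
    then show ?thesis
      using linear_isometry_on_inj[OF gen_isometry[OF l(1)]] K w gen_K[of p w] that
      by (simp add: inj_on_def closed_csubspace_def)
  qed
  then show thesis
    using w by (intro that[of w]) (simp_all add: T_iff)
qed

lemma foldr_T_preimage:
  assumes "\<forall>l\<in>set ls. 1 \<le> l \<and> l < m" "x \<in> T m"
  obtains w where "w \<in> T m" "foldr \<sigma> ls w = x"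
proof -
  have "\<exists>w\<in>T m. foldr \<sigma> ls w = x"
    using assms
  proof (induction ls arbitrary: x)
    case (Cons l ls)
    obtain y where y: "y \<in> T m" "\<sigma> l y = x"
      using gen_T_preimage[of l m x] Cons.prems by auto
    then show ?case
      using Cons.IH[OF _ y(1)] Cons.prems by auto
  qed auto
  then show thesis
    using that by blast
qed

lemma gen_isometry_M:
  assumes l: "1 \<le> l"
  shows "linear_isometry_on M M (\<sigma> l)"
proof -
  have "\<sigma> l x \<in> M" if "x \<in> M" for x
  proof (rule linear_isometry_on_closed_cspan[OF gen_isometry[OF l] K _ _ M])
    show "x \<in> closed_cspan (\<Union>n. T n)"
      using that by (simp add: M_eq)
    show "(\<Union>n. T n) \<subseteq> K"
      by (auto simp: T_iff)
    fix g
    assume "g \<in> (\<Union>n. T n)"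
    then obtain n where "g \<in> T n"
      by blast
    then have "g \<in> T (max n (Suc l))"
      using T_mono[of n "max n (Suc l)"] by auto
    then have "\<sigma> l g \<in> T (max n (Suc l))"
      using l by (intro gen_T) auto
    then show "\<sigma> l g \<in> M"
      by (rule T_M)
  qed
  then show ?thesis
    by (intro linear_isometry_on_subset[OF gen_isometry[OF l] M_subset_K]) auto
qed

text \<open>On \<open>T m\<close> with \<open>m > l\<close>, which \<open>\<sigma> l\<close>
  preserves, \<open>\<alpha> i\<close> is a finite product and \<open>foldr_gen\<close> applies;
  density does the rest.\<close>

lemma shift_gen:
  assumes l: "Suc i \<le> l" and x: "x \<in> M"
  shows "\<alpha> i (\<sigma> l x) = \<sigma> (Suc l) (\<alpha> i x)"
proof -
  have "(\<alpha> i \<circ> \<sigma> l) x = (\<sigma> (Suc l) \<circ> \<alpha> i) x"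
  proof (rule linear_isometry_on_eq_closed_cspan[OF linear_isometry_on_comp[OF gen_isometry_M shift]
        linear_isometry_on_comp[OF shift gen_isometry_M] M])
    show "x \<in> closed_cspan (\<Union>n. T n)"
      using x by (simp add: M_eq)
    show "(\<Union>n. T n) \<subseteq> M"
      by (intro UN_least T_subset_M)
    fix g
    assume "g \<in> (\<Union>n. T n)"
    then obtain n where n: "g \<in> T n"
      by blast
    define m where "m = max n (Suc l)"
    have g: "g \<in> T m"
      using n T_mono[of n m] by (auto simp: m_def)
    moreover have "\<sigma> l g \<in> T m"
      using l g by (intro gen_T) (auto simp: m_def)
    moreover have "i \<le> m"
      using l by (simp add: m_def)
    ultimately show "(\<alpha> i \<circ> \<sigma> l) g = (\<sigma> (Suc l) \<circ> \<alpha> i) g"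
      using foldr_gen[OF l, of m g] by (simp add: shift_eq_foldr T_iff m_def del: upt_Suc)
  qed (use l in auto)
  then show ?thesis
    by simp
qed

lemma foldr_shift:
  assumes "\<forall>l\<in>set ls. Suc i \<le> l" "x \<in> M"
  shows "\<alpha> i (foldr \<sigma> ls x) = foldr \<sigma> (map Suc ls) (\<alpha> i x)"
  using assms(1)
proof (induction ls)
  case (Cons l ls)
  have "linear_isometry_on M M (foldr \<sigma> ls)"
    using Cons.prems by (intro foldr_linear_isometry gen_isometry_M) auto
  then have "foldr \<sigma> ls x \<in> M"
    using assms(2) linear_isometry_onD(1) by blast
  then show ?case
    using Cons by (simp add: shift_gen)
qed simp

text \<open>The adjoint of \<open>\<alpha> i\<close> maps \<open>z\<close> to a vector fixed by all \<open>\<sigma> l\<close>, \<open>l > k\<close>, hence to one in \<open>T k\<close>.\<close>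

lemma perp_T_imp_perp:
  assumes ik: "i \<le> k" and z: "z \<in> T (Suc k)" and perp: "\<And>y. y \<in> T k \<Longrightarrow> cinner z (\<alpha> i y) = 0"
  shows "perp i z"
proof -
  obtain u where u: "u \<in> M" "\<And>w. w \<in> M \<Longrightarrow> cinner z (\<alpha> i w) = cinner u w"
    using shift_adjoint[OF T_M[OF z]] by blast
  have zK: "z \<in> K"
    using z by (simp add: T_iff)
  have "\<sigma> l u = u" if "l > k" for l
  proof -
    have l: "1 \<le> l" "Suc i \<le> l"
      using that ik by auto
    have M: "\<sigma> l u \<in> M" "\<alpha> i u \<in> K"
      using u(1) linear_isometry_onD(1)[OF gen_isometry_M[OF l(1)]] shift_M M_subset_K by auto
    \<comment> \<open>Across \<open>\<alpha> i\<close> the generator becomes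
      \<open>\<sigma> (Suc l)\<close>, which fixes \<open>z\<close> because
      \<open>l + 1 > k + 1\<close>.\<close>
    have "cinner u (\<sigma> l u) = cinner z (\<sigma> (Suc l) (\<alpha> i u))"
      using u(2)[OF M(1)] shift_gen[OF l(2) u(1)] by simp
    also have "\<dots> = cinner (\<sigma> (Suc l) z) (\<sigma> (Suc l) (\<alpha> i u))"
      using gen_fixes_T[OF z, of "Suc l"] that by simp
    also have "\<dots> = cinner z (\<alpha> i u)"
      using linear_isometry_on_cinner[OF gen_isometry[of "Suc l"] _ zK M(2)] K
      by (simp add: closed_csubspace_def)
    also have "\<dots> = cinner u u"
      using u by simp
    finally show ?thesis
      using linear_isometry_onD(4)[OF gen_isometry_M[OF l(1)] u(1)]
      by (intro eq_if_cinner_eq_norm_square[of u "\<sigma> l u"]) (simp_all only: cinner_self)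
  qed
  then have "u \<in> T k"
    using u(1) M_subset_K by (auto simp: T_iff)
  \<comment> \<open>Now \<open>u\<close> itself is an admissible test vector \<open>y\<close>, so
    the adjoint of \<open>\<alpha> i\<close> annihilates \<open>z\<close>.\<close>
  then have "cinner u u = 0"
    using perp u by metis
  then show ?thesis
    using u(2) by (simp add: perp_def cinner.zero_left)
qed

text \<open>Write \<open>y\<close> as the product of \<open>\<sigma> j\<close> to
  \<open>\<sigma> k\<close> applied to \<open>w\<close>. Moving \<open>\<alpha> i\<close> across
  raises all indices by one and produces the very product that represents \<open>\<alpha> j\<close>
  on \<open>z\<close>. This isometry cancels, leaving \<open>cinner z (\<alpha> i w)\<close>. As
  \<open>w\<close> lies one level above \<open>T k\<close>, orthogonality of \<open>z\<close> to the
  whole range of \<open>\<alpha> i\<close> is needed.\<close>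

lemma normal: normal_tower
  unfolding normal_tower_def
proof (intro allI impI ballI, elim conjE)
  fix k i j z y
  assume ij: "i < j" "i \<le> k" "j \<le> k + 1" and z: "z \<in> T (Suc k)" and y: "y \<in> T (Suc k)"
    and z_perp: "\<forall>y\<in>T k. cinner z (\<alpha> i y) = 0"
  have perp: "perp i z"
    using ij z z_perp by (intro perp_T_imp_perp) auto
  obtain w where w: "w \<in> T (Suc k)" "foldr \<sigma> [j..<Suc k] w = y"
  proof (rule foldr_T_preimage)
    show "\<forall>l\<in>set [j..<Suc k]. 1 \<le> l \<and> l < Suc k"
      using ij by auto
  qed (use y in auto)
  have wM: "w \<in> M"
    by (rule T_M[OF w(1)])
  have \<alpha>w: "\<alpha> i w \<in> K" and zK: "z \<in> K"
    using shift_M[OF wM] z M_subset_K by (auto simp: T_iff)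
  have "\<alpha> i y = foldr \<sigma> (map Suc [j..<Suc k]) (\<alpha> i w)"
    unfolding w(2)[symmetric] using ij by (intro foldr_shift wM) auto
  then have "\<alpha> i y = foldr \<sigma> [Suc j..<Suc (Suc k)] (\<alpha> i w)"
    by (simp only: map_Suc_upt)
  moreover have "\<alpha> j z = foldr \<sigma> [Suc j..<Suc (Suc k)] z"
    using ij z by (intro shift_eq_foldr) auto
  ultimately have "cinner (\<alpha> j z) (\<alpha> i y) = cinner z (\<alpha> i w)"
    using linear_isometry_on_cinner[OF foldr_isometry[of "[Suc j..<Suc (Suc k)]"] _ zK \<alpha>w] K
    by (simp add: closed_csubspace_def del: upt_Suc)
  also have "\<dots> = 0"
    using perp wM by (simp add: perp_def)
  finally show "cinner (\<alpha> j z) (\<alpha> i y) = 0" .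
qed

end


section \<open>From the symmetric group to the braid group\<close>

text \<open>The sign of a letter is dropped since a transposition is its own inverse.\<close>

definition braid_permutation :: "braid_word \<Rightarrow> nat \<Rightarrow> nat"
  where "braid_permutation w = foldr symmetric_gen (map fst w)"

lemma braid_permutation_append:
  "braid_permutation (u @ v) = braid_permutation u \<circ> braid_permutation v"
  by (simp add: braid_permutation_def fun_eq_iff)

lemma braid_permutation_cong: "braid_eq u v \<Longrightarrow> braid_permutation u = braid_permutation v"
proof (induction rule: braid_eq.induct)
  case (append v v' w w')
  then show ?case
    by (simp add: braid_permutation_append)
qed (auto simp: braid_permutation_def symmetric_gen_def Transposition.transpose_def fun_eq_iff)

lemma braid_permutation_carrier:
  assumes "w \<in> braid_words"
  shows "braid_permutation w \<in> carrier infinite_symmetric_group"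
  using assms
proof (induction w)
  case Nil
  then show ?case
    by (simp add: braid_permutation_def infinite_symmetric_group_def flip: id_def)
next
  case (Cons a w)
  then have w: "bij (braid_permutation w)" "finite {i. braid_permutation w i \<noteq> i}"
    by (auto simp: braid_words_def infinite_symmetric_group_def)
  have a: "bij (symmetric_gen (fst a))"
    by (simp add: symmetric_gen_def)
  have eq: "braid_permutation (a # w) = symmetric_gen (fst a) \<circ> braid_permutation w"
    by (simp add: braid_permutation_def)
  have "{i. braid_permutation (a # w) i \<noteq> i} \<subseteq> {i. braid_permutation w i \<noteq> i} \<union> {fst a - 1, fst a}"
    unfolding eq by (auto simp: symmetric_gen_def Transposition.transpose_def)
  then have "finite {i. braid_permutation (a # w) i \<noteq> i}"
    using w(2) by (meson finite.emptyI finite.insertI finite_UnI finite_subset)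
  then show ?case
    unfolding infinite_symmetric_group_def using bij_comp[OF w(1) a] by (simp add: eq comp_def)
qed

lemma symmetric_imp_braided:
  assumes "symmetric_sch H \<delta> \<iota>"
  shows "braided_sch H \<delta> \<iota>"
proof -
  obtain K U where U: "unitary_rep infinite_symmetric_group K U"
    and canonical: "saturation_is_canonical H \<delta> \<iota> K (\<lambda>m. U (symmetric_gen m))"
    using assms by (auto simp: symmetric_sch_def)
  \<comment> \<open>The homomorphism onto permutations, read off an arbitrary representative;
    \<open>braid_permutation_cong\<close> makes the choice harmless.\<close>
  define \<phi> where "\<phi> X = braid_permutation (SOME w. w \<in> X)" for X
  have \<phi>: "\<phi> (braid_class w) = braid_permutation w" if "w \<in> braid_words" for w
  proof -
    have "w \<in> braid_class w"
      using that braid_eq.refl by (simp add: braid_class_def)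
    then have "(SOME v. v \<in> braid_class w) \<in> braid_class w"
      by (rule someI)
    then show ?thesis
      using braid_permutation_cong by (simp add: \<phi>_def braid_class_def)
  qed
  have carrier: "carrier braid_group = braid_class ` braid_words"
    by (simp add: braid_group_def)
  have "\<phi> \<in> hom braid_group infinite_symmetric_group"
  proof (rule homI)
    show "\<phi> X \<in> carrier infinite_symmetric_group" if "X \<in> carrier braid_group" for X
      using that \<phi> braid_permutation_carrier by (auto simp: carrier)
    fix X Y
    assume "X \<in> carrier braid_group" "Y \<in> carrier braid_group"
    then obtain u v where uv: "u \<in> braid_words" "v \<in> braid_words" "X = braid_class u" "Y = braid_class v"
      by (auto simp: carrier)
    moreover have "u @ v \<in> braid_words"
      using uv by (auto simp: braid_words_def)
    ultimately show "\<phi> (X \<otimes>\<^bsub>braid_group\<^esub> Y) = \<phi> X \<otimes>\<^bsub>infinite_symmetric_group\<^esub> \<phi> Y"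
      by (simp add: braid_mult \<phi> braid_permutation_append infinite_symmetric_group_def)
  qed
  then have "U \<circ> \<phi> \<in> hom braid_group (unitary_group K)"
    using U hom_compose[of \<phi> braid_group infinite_symmetric_group U "unitary_group K"]
    by (simp add: unitary_rep_def)
  then have "unitary_rep braid_group K (U \<circ> \<phi>)"
    using U by (simp add: unitary_rep_def)
  \<comment> \<open>Agreement for \<open>m \<ge> 1\<close> suffices: the tower involves indices
    \<open>l > n\<close>, the shifts indices from \<open>i + 1\<close> on.\<close>
  moreover have gen: "(U \<circ> \<phi>) (braid_gen m) = U (symmetric_gen m)" if "m \<ge> 1" for m
    using that \<phi>[of "[(m, True)]"] by (simp add: braid_gen_def braid_words_def braid_permutation_def comp_def)
  moreover have "canonical_tower K (\<lambda>m. (U \<circ> \<phi>) (braid_gen m)) n =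
      canonical_tower K (\<lambda>m. U (symmetric_gen m)) n" for n
    using gen by (auto simp: canonical_tower_def)
  moreover have "canonical_shift (\<lambda>m. (U \<circ> \<phi>) (braid_gen m)) i x =
      canonical_shift (\<lambda>m. U (symmetric_gen m)) i x" for i x
    unfolding canonical_shift_def by (intro arg_cong[of _ _ lim] ext foldr_cong) (auto simp: gen[unfolded comp_def])
  ultimately show ?thesis
    using canonical unfolding braided_sch_def saturation_is_canonical_def by metis
qed


section \<open>Semi-cosimplicial Hilbert spaces as towers\<close>

text \<open>The adjoint at \<open>y\<close> is the preimage of the projection of \<open>y\<close>
  onto the range, so a residual orthogonal to the range identifies it.\<close>

lemma adjoint_on_eqI:
  assumes f: "linear_isometry_on S R f" and S: "closed_csubspace S" and u: "u \<in> S"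
    and perp: "\<And>s. s \<in> S \<Longrightarrow> cinner (y - f u) (f s) = 0"
  shows "adjoint_on S f y = u"
  unfolding adjoint_on_def
proof (rule the_equality)
  have "cinner (f z) y = cinner z u" if z: "z \<in> S" for z
  proof -
    have "cinner (f z) (y - f u) = 0"
      using perp[OF z] by (subst cinner_eq_zero_commute)
    then show ?thesis
      using linear_isometry_on_cinner[OF f _ z u] S
      by (simp add: cinner.diff_right closed_csubspace_def)
  qed
  then show *: "u \<in> S \<and> (\<forall>z\<in>S. cinner (f z) y = cinner z u)"
    using u by blast
  fix x
  assume x: "x \<in> S \<and> (\<forall>z\<in>S. cinner (f z) y = cinner z x)"
  then have "x - u \<in> S"
    using u by (intro closed_csubspace_diff[OF S]) auto
  then have "cinner (x - u) x = cinner (x - u) u"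
    using x * by metis
  then have "cinner (x - u) (x - u) = 0"
    by (simp add: cinner.diff_right)
  then show "x = u"
    by simp
qed

lemma adjoint_on:
  assumes f: "linear_isometry_on S R f" and S: "closed_csubspace S"
  shows "adjoint_on S f y \<in> S" and "s \<in> S \<Longrightarrow> cinner (y - f (adjoint_on S f y)) (f s) = 0"
proof -
  obtain p where p: "p \<in> f ` S" "\<And>s. s \<in> f ` S \<Longrightarrow> cinner (y - p) s = 0"
    using orthogonal_projection[OF closed_csubspace_linear_isometry_image[OF f S], where x = y]
    by blast
  then obtain u where u: "u \<in> S" "p = f u"
    by blast
  then have "adjoint_on S f y = u"
    using p by (intro adjoint_on_eqI[OF f S]) auto
  then show "adjoint_on S f y \<in> S" "s \<in> S \<Longrightarrow> cinner (y - f (adjoint_on S f y)) (f s) = 0"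
    using u p by auto
qed

section \<open>Normality and complements of the coface ranges\<close>

context
  fixes H :: "nat \<Rightarrow> 'a::chilbert_space set"
    and \<delta> :: "nat \<Rightarrow> nat \<Rightarrow> 'a \<Rightarrow> 'a"
  assumes sch: "sch H \<delta>"
begin

lemma sch_closed_csubspace: "closed_csubspace (H n)"
  and sch_coface: "i \<le> n \<Longrightarrow> linear_isometry_on (H n) (H (Suc n)) (\<delta> n i)"
  and sch_cosimplicial: "i < j \<Longrightarrow> j \<le> Suc n \<Longrightarrow> x \<in> H n \<Longrightarrow>
    \<delta> (Suc n) j (\<delta> n i x) = \<delta> (Suc n) i (\<delta> n (j - 1) x)"
  using sch by (auto simp: sch_def closed_csubspace_def)

lemma sch_coface_mem: "i \<le> n \<Longrightarrow> x \<in> H n \<Longrightarrow> \<delta> n i x \<in> H (Suc n)"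
  by (rule linear_isometry_onD(1)[OF sch_coface])

lemma sch_coface_diff: "i \<le> n \<Longrightarrow> x \<in> H n \<Longrightarrow> y \<in> H n \<Longrightarrow> \<delta> n i (x - y) = \<delta> n i x - \<delta> n i y"
  using linear_isometry_on_diff[OF sch_coface] sch_closed_csubspace by (simp add: closed_csubspace_def)

definition preserves_complements :: bool
  where "preserves_complements \<longleftrightarrow>
    (\<forall>k i j. i < j \<and> j \<le> k + 1 \<and> i \<le> k \<longrightarrow>
      (\<forall>z\<in>H (Suc k). (\<forall>y\<in>H k. cinner z (\<delta> k i y) = 0) \<longrightarrow>
        (\<forall>y\<in>H (Suc k). cinner (\<delta> (Suc k) j z) (\<delta> (Suc k) i y) = 0)))"

lemma preserves_complements_iff:
  "preserves_complements \<longleftrightarrow>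
    (\<forall>k i j. i < j \<and> j \<le> k + 1 \<and> i \<le> k \<longrightarrow>
      \<delta> (Suc k) j ` (H (Suc k) \<ominus>\<^sub>H \<delta> k i ` H k) \<subseteq>
        H (Suc (Suc k)) \<ominus>\<^sub>H \<delta> (Suc k) i ` H (Suc k))"
proof -
  have eq: "\<delta> (Suc k) j ` (H (Suc k) \<ominus>\<^sub>H \<delta> k i ` H k) \<subseteq>
        H (Suc (Suc k)) \<ominus>\<^sub>H \<delta> (Suc k) i ` H (Suc k) \<longleftrightarrow>
      (\<forall>z\<in>H (Suc k). (\<forall>y\<in>H k. cinner z (\<delta> k i y) = 0) \<longrightarrow>
        (\<forall>y\<in>H (Suc k). cinner (\<delta> (Suc k) j z) (\<delta> (Suc k) i y) = 0))"
    if "j \<le> k + 1" for k i j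
    using sch_coface_mem[of j "Suc k"] that by (auto simp: ominus_def image_subset_iff)
  show ?thesis
    unfolding preserves_complements_def
    by (rule iff_allI)+ (rule imp_cong[OF HOL.refl eq[symmetric]], simp)
qed

text \<open>On the complement of the range of \<open>\<delta> k i\<close> the adjoint vanishes, so
  the identity gives (d). Conversely, split \<open>x\<close> into \<open>\<delta> k i u\<close> and
  a part in the complement: by (d) the latter contributes nothing, and the cosimplicial relation
  turns the former into the contribution \<open>\<delta> k (j - 1) u\<close>.\<close>

lemma normal_sch_iff: "normal_sch H \<delta> \<longleftrightarrow> preserves_complements"
proof
  assume normal: "normal_sch H \<delta>"
  show preserves_complements
    unfolding preserves_complements_def
  proof (intro allI impI ballI, elim conjE)
    fix k i j z y
    assume ij: "i < j" "j \<le> k + 1" "i \<le> k" and z: "z \<in> H (Suc k)" and y: "y \<in> H (Suc k)"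
      and perp: "\<forall>y\<in>H k. cinner z (\<delta> k i y) = 0"
    have zero: "\<delta> n l 0 = 0" if "l \<le> n" for n l
      using sch_coface_diff[OF that, of 0 0] closed_csubspace_0[OF sch_closed_csubspace] by simp
    have "adjoint_on (H k) (\<delta> k i) z = 0"
      using ij perp zero closed_csubspace_0[OF sch_closed_csubspace]
      by (intro adjoint_on_eqI[OF sch_coface sch_closed_csubspace]) auto
    then have "\<delta> k (j - 1) 0 = adjoint_on (H (Suc k)) (\<delta> (Suc k) i) (\<delta> (Suc k) j z)"
      using normal ij z unfolding normal_sch_def by metis
    then have "adjoint_on (H (Suc k)) (\<delta> (Suc k) i) (\<delta> (Suc k) j z) = 0"
      using zero[of "j - 1" k] ij by simp
    then show "cinner (\<delta> (Suc k) j z) (\<delta> (Suc k) i y) = 0"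
      using adjoint_on(2)[OF sch_coface[of i "Suc k"] sch_closed_csubspace y, of "\<delta> (Suc k) j z"]
        ij zero[of i "Suc k"] by simp
  qed
next
  assume pres: preserves_complements
  show "normal_sch H \<delta>"
    unfolding normal_sch_def
  proof (intro allI impI ballI, elim conjE)
    fix k i j x
    assume ij: "i < j" "j \<le> k + 1" and x: "x \<in> H (Suc k)"
    then have ik: "i \<le> k" "i \<le> Suc k" "j \<le> Suc k"
      by auto
    define u where "u = adjoint_on (H k) (\<delta> k i) x"
    have u: "u \<in> H k" "\<And>s. s \<in> H k \<Longrightarrow> cinner (x - \<delta> k i u) (\<delta> k i s) = 0"
      unfolding u_def using adjoint_on[OF sch_coface[OF ik(1)] sch_closed_csubspace] by auto
    have z: "x - \<delta> k i u \<in> H (Suc k)"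
      using x u ik sch_coface_mem by (intro closed_csubspace_diff sch_closed_csubspace) auto
    have "adjoint_on (H (Suc k)) (\<delta> (Suc k) i) (\<delta> (Suc k) j x) = \<delta> k (j - 1) u"
    proof (rule adjoint_on_eqI[OF sch_coface[OF ik(2)] sch_closed_csubspace])
      show "\<delta> k (j - 1) u \<in> H (Suc k)"
        using u ij by (intro sch_coface_mem) auto
      fix s
      assume "s \<in> H (Suc k)"
      then have "cinner (\<delta> (Suc k) j (x - \<delta> k i u)) (\<delta> (Suc k) i s) = 0"
        using pres u z ij ik unfolding preserves_complements_def by blast
      then show "cinner (\<delta> (Suc k) j x - \<delta> (Suc k) i (\<delta> k (j - 1) u)) (\<delta> (Suc k) i s) = 0"
        using u ik x sch_coface_mem[of i k u] sch_cosimplicial[OF ij(1) ik(3) u(1)]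
        by (simp add: sch_coface_diff)
    qed
    then show "\<delta> k (j - 1) (adjoint_on (H k) (\<delta> k i) x) =
        adjoint_on (H (Suc k)) (\<delta> (Suc k) i) (\<delta> (Suc k) j x)"
      by (simp add: u_def)
  qed
qed

section \<open>The embedded tower and its partial shifts\<close>

context
  fixes \<iota> :: "nat \<Rightarrow> 'a \<Rightarrow> 'b::chilbert_space"
  assumes emb: "tower_embedding H \<delta> \<iota>"
begin

lemma emb_isometry: "linear_isometry_on (H n) UNIV (\<iota> n)"
  and emb_top: "x \<in> H n \<Longrightarrow> \<iota> (Suc n) (\<delta> n n x) = \<iota> n x"
  using emb by (auto simp: tower_embedding_def)

lemma emb_cinner: "x \<in> H n \<Longrightarrow> y \<in> H n \<Longrightarrow> cinner (\<iota> n x) (\<iota> n y) = cinner x y"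
  using linear_isometry_on_cinner[OF emb_isometry] sch_closed_csubspace
  by (simp add: closed_csubspace_def)

lemma emb_image_mono: "m \<le> n \<Longrightarrow> \<iota> m ` H m \<subseteq> \<iota> n ` H n"
proof (induction n rule: dec_induct)
  case (step n)
  have "\<iota> n ` H n \<subseteq> \<iota> (Suc n) ` H (Suc n)"
    using emb_top[symmetric] sch_coface_mem[of n n] by auto
  then show ?case
    using step by blast
qed simp

lemma H_infinity_eq: "H_infinity H \<iota> = closed_cspan (\<Union>n. \<iota> n ` H n)"
proof
  have sub: "csubspace (\<iota> n ` H n)" for n
    using csubspace_linear_isometry_image[OF emb_isometry] sch_closed_csubspace
    by (simp add: closed_csubspace_def)
  have "x + y \<in> (\<Union>n. \<iota> n ` H n)" if xy: "x \<in> (\<Union>n. \<iota> n ` H n)" "y \<in> (\<Union>n. \<iota> n ` H n)" for x y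
  proof -
    obtain m n where mn: "x \<in> \<iota> m ` H m" "y \<in> \<iota> n ` H n"
      using xy by blast
    have "x \<in> \<iota> (max m n) ` H (max m n)" "y \<in> \<iota> (max m n) ` H (max m n)"
      using mn emb_image_mono[of m "max m n"] emb_image_mono[of n "max m n"] by auto
    then have "x + y \<in> \<iota> (max m n) ` H (max m n)"
      using sub[of "max m n"] unfolding csubspace_def by blast
    then show ?thesis
      by blast
  qed
  moreover have "0 \<in> (\<Union>n. \<iota> n ` H n)"
    using sub[of 0] unfolding csubspace_def by blast
  moreover have "c *\<^sub>C x \<in> (\<Union>n. \<iota> n ` H n)" if "x \<in> (\<Union>n. \<iota> n ` H n)" for c x
  proof -
    obtain n where "x \<in> \<iota> n ` H n"
      using \<open>x \<in> (\<Union>n. \<iota> n ` H n)\<close> by blast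
    then have "c *\<^sub>C x \<in> \<iota> n ` H n"
      using sub[of n] unfolding csubspace_def by blast
    then show ?thesis
      by blast
  qed
  ultimately have "csubspace (\<Union>n. \<iota> n ` H n)"
    unfolding csubspace_def by (intro conjI allI ballI)
  then show "closed_cspan (\<Union>n. \<iota> n ` H n) \<subseteq> H_infinity H \<iota>"
    unfolding H_infinity_def by (intro closed_cspan_minimal closed_csubspace_closure closure_subset)
  show "H_infinity H \<iota> \<subseteq> closed_cspan (\<Union>n. \<iota> n ` H n)"
    unfolding H_infinity_def
    by (intro closure_minimal closed_cspan_superset closed_csubspace_closed closed_csubspace_closed_cspan)
qed

text \<open>Vectors from different levels are compared at a common one. Passing up a level is
  consistent because \<open>\<delta> (Suc k) n\<close> after the top coface
  \<open>\<delta> k k\<close> equals the top coface after \<open>\<delta> k n\<close>, and top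
  cofaces are inclusions under \<open>\<iota>\<close>.\<close>

lemma ex_partial_shift:
  "\<exists>a. linear_isometry_on (H_infinity H \<iota>) (H_infinity H \<iota>) a \<and>
    (\<forall>k\<ge>n. \<forall>x\<in>H k. a (\<iota> k x) = \<iota> (Suc k) (\<delta> k n x))"
proof -
  define B where "B k = (\<lambda>x. (\<iota> k x, \<iota> (Suc k) (\<delta> k n x))) ` H k" for k
  have B_Suc: "B k \<subseteq> B (Suc k)" if k: "n \<le> k" for k
  proof
    fix p
    assume "p \<in> B k"
    then obtain x where x: "x \<in> H k" "p = (\<iota> k x, \<iota> (Suc k) (\<delta> k n x))"
      by (auto simp: B_def)
    have "p = (\<iota> (Suc k) (\<delta> k k x), \<iota> (Suc (Suc k)) (\<delta> (Suc k) n (\<delta> k k x)))"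
      using x k sch_cosimplicial[of n "Suc k" k x] emb_top[OF x(1)] emb_top[OF sch_coface_mem[OF k x(1)]]
      by simp
    then show "p \<in> B (Suc k)"
      using sch_coface_mem[of k k x] x by (auto simp: B_def)
  qed
  have B_mono: "B k \<subseteq> B m" if "n \<le> k" "k \<le> m" for k m
    using that(2,1)
  proof (induction m rule: dec_induct)
    case (step m)
    then show ?case
      using B_Suc[of m] by auto
  qed simp
  have gram: "cinner (fst p) (fst q) = cinner (snd p) (snd q)"
    if pq: "p \<in> (\<Union>k\<in>{n..}. B k)" "q \<in> (\<Union>k\<in>{n..}. B k)" for p q
  proof -
    from pq obtain k l where kl: "n \<le> k" "p \<in> B k" "n \<le> l" "q \<in> B l"
      by auto
    define m where "m = max k l"
    have m: "n \<le> m" "p \<in> B m" "q \<in> B m"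
      using kl B_mono[of k m] B_mono[of l m] by (auto simp: m_def)
    then obtain x y where "x \<in> H m" "p = (\<iota> m x, \<iota> (Suc m) (\<delta> m n x))"
      "y \<in> H m" "q = (\<iota> m y, \<iota> (Suc m) (\<delta> m n y))"
      by (auto simp: B_def)
    then show ?thesis
      using m(1) sch_coface_mem linear_isometry_on_cinner[OF sch_coface[OF m(1)]]
        sch_closed_csubspace[of m]
      by (simp add: emb_cinner closed_csubspace_def)
  qed
  obtain a where a: "linear_isometry_on (closed_cspan (fst ` (\<Union>k\<in>{n..}. B k)))
      (closed_cspan (snd ` (\<Union>k\<in>{n..}. B k))) a"
    "\<And>x y. (x, y) \<in> (\<Union>k\<in>{n..}. B k) \<Longrightarrow> a x = y"
    using isometric_extension[OF gram] by blast
  have "(\<Union>m. \<iota> m ` H m) \<subseteq> fst ` (\<Union>k\<in>{n..}. B k)"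
  proof
    fix x
    assume "x \<in> (\<Union>m. \<iota> m ` H m)"
    then obtain m where "x \<in> \<iota> m ` H m"
      by blast
    then have "x \<in> \<iota> (max m n) ` H (max m n)"
      using emb_image_mono[of m "max m n"] by auto
    then obtain y where "(x, y) \<in> B (max m n)"
      by (force simp: B_def)
    then have "(x, y) \<in> (\<Union>k\<in>{n..}. B k)"
      by (intro UN_I[of "max m n"]) simp_all
    then show "x \<in> fst ` (\<Union>k\<in>{n..}. B k)"
      by (rule image_eqI[rotated]) simp
  qed
  then have dom: "H_infinity H \<iota> \<subseteq> closed_cspan (fst ` (\<Union>k\<in>{n..}. B k))"
    unfolding H_infinity_eq by (rule closed_cspan_mono)
  have "snd ` B k \<subseteq> \<iota> (Suc k) ` H (Suc k)" if "n \<le> k" for k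
    using sch_coface_mem[OF that] by (auto simp: B_def)
  then have "snd ` (\<Union>k\<in>{n..}. B k) \<subseteq> (\<Union>m. \<iota> m ` H m)"
    by (simp add: image_UN) blast
  then have ran: "closed_cspan (snd ` (\<Union>k\<in>{n..}. B k)) \<subseteq> H_infinity H \<iota>"
    unfolding H_infinity_eq by (rule closed_cspan_mono)
  have "linear_isometry_on (H_infinity H \<iota>) (H_infinity H \<iota>) a"
    using linear_isometry_onD(1)[OF a(1)] dom ran by (intro linear_isometry_on_subset[OF a(1)]) blast+
  moreover have "a (\<iota> k x) = \<iota> (Suc k) (\<delta> k n x)" if "k \<ge> n" "x \<in> H k" for k x
    using that by (intro a(2)) (auto simp: B_def)
  ultimately show ?thesis
    by blast
qed

lemma partial_shift_isometry:
    "linear_isometry_on (H_infinity H \<iota>) (H_infinity H \<iota>) (partial_shift H \<delta> \<iota> n)"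
  and partial_shift_emb:
    "n \<le> k \<Longrightarrow> x \<in> H k \<Longrightarrow> partial_shift H \<delta> \<iota> n (\<iota> k x) = \<iota> (Suc k) (\<delta> k n x)"
  using someI_ex[OF ex_partial_shift[of n]] unfolding partial_shift_def by blast+

lemma shift_tower_sch: "shift_tower (H_infinity H \<iota>) (\<lambda>n. \<iota> n ` H n) (partial_shift H \<delta> \<iota>)"
proof
  show "closed_csubspace (\<iota> n ` H n)" for n
    by (rule closed_csubspace_linear_isometry_image[OF emb_isometry sch_closed_csubspace])
  show "\<iota> n ` H n \<subseteq> \<iota> (Suc n) ` H (Suc n)" for n
    by (rule emb_image_mono) simp
  show "H_infinity H \<iota> = closed_cspan (\<Union>n. \<iota> n ` H n)"
    by (rule H_infinity_eq)
  show "linear_isometry_on (H_infinity H \<iota>) (H_infinity H \<iota>) (partial_shift H \<delta> \<iota> n)" for n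
    by (rule partial_shift_isometry)
  show "partial_shift H \<delta> \<iota> n x \<in> \<iota> (Suc k) ` H (Suc k)" if "n \<le> k" "x \<in> \<iota> k ` H k" for n k x
    using that sch_coface_mem by (auto simp: partial_shift_emb)
  show "partial_shift H \<delta> \<iota> n x = x" if "x \<in> \<iota> n ` H n" for n x
    using that by (auto simp: partial_shift_emb emb_top)
  show "partial_shift H \<delta> \<iota> j (partial_shift H \<delta> \<iota> i x) =
      partial_shift H \<delta> \<iota> i (partial_shift H \<delta> \<iota> (j - 1) x)"
    if ij: "i < j" "j \<le> Suc k" and x: "x \<in> \<iota> k ` H k" for i j k x
  proof -
    obtain y where y: "y \<in> H k" "x = \<iota> k y"
      using x by blast
    have "i \<le> k" "i \<le> Suc k" "j - 1 \<le> k"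
      using ij by auto
    then show ?thesis
      using y ij sch_cosimplicial[OF ij y(1)] by (simp add: partial_shift_emb sch_coface_mem)
  qed
qed

interpretation shift_tower "H_infinity H \<iota>" "\<lambda>n. \<iota> n ` H n" "partial_shift H \<delta> \<iota>"
  by (rule shift_tower_sch)

section \<open>Translation of the conditions to the embedded tower\<close>

lemma normal_tower_iff: "normal_tower \<longleftrightarrow> preserves_complements"
proof -
  have "cinner (\<iota> (Suc k) z) (partial_shift H \<delta> \<iota> i (\<iota> k y)) = cinner z (\<delta> k i y)"
    if "i \<le> k" "z \<in> H (Suc k)" "y \<in> H k" for k i z y
    using that by (simp add: partial_shift_emb emb_cinner sch_coface_mem)
  moreover have "cinner (partial_shift H \<delta> \<iota> j (\<iota> (Suc k) z)) (partial_shift H \<delta> \<iota> i (\<iota> (Suc k) y)) =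
      cinner (\<delta> (Suc k) j z) (\<delta> (Suc k) i y)"
    if "i < j" "j \<le> k + 1" "z \<in> H (Suc k)" "y \<in> H (Suc k)" for k i j z y
    using that by (simp add: partial_shift_emb emb_cinner sch_coface_mem)
  ultimately show ?thesis
    unfolding normal_tower_def preserves_complements_def by simp
qed

lemma root_space_eq: "root_space r = \<iota> r ` root_subspace H \<delta> r"
proof -
  have "cinner (\<iota> r x) (partial_shift H \<delta> \<iota> i (\<iota> (r - 1) y)) = cinner x (\<delta> (r - 1) i y)"
    if "i < r" "x \<in> H r" "y \<in> H (r - 1)" for i x y
  proof -
    obtain k where k: "r = Suc k" "i \<le> k"
      using \<open>i < r\<close> by (cases r) auto
    then show ?thesis
      using that by (simp add: partial_shift_emb emb_cinner sch_coface_mem)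
  qed
  then show ?thesis
    unfolding root_space_def root_subspace_def by auto
qed

lemma fill_eq_cofaces:
  fixes A n
  defines "gaps \<equiv> filter (\<lambda>i. i \<notin> A) [0..<n]"
  assumes A: "finite A" and x: "x \<in> H (card A)"
  shows "cofaces \<delta> (card A) gaps x \<in> H (card A + length gaps) \<and>
    fill A n (\<iota> (card A) x) = \<iota> (card A + length gaps) (cofaces \<delta> (card A) gaps x)"
  unfolding gaps_def
proof (induction n)
  case (Suc n)
  have cofaces_append: "cofaces \<delta> r (is @ js) x = cofaces \<delta> (r + length is) js (cofaces \<delta> r is x)"
    for r "is" js x
    by (induction "is" arbitrary: r x) auto
  let ?gaps = "filter (\<lambda>i. i \<notin> A) [0..<n]"
  \<comment> \<open>The coface with index \<open>n\<close> makes sense only if the level reached is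
    at least \<open>n\<close>. Positions below \<open>n\<close> are gaps, each of which raised the
    level, or elements of \<open>A\<close>, covered by the initial level
    \<open>card A\<close>.\<close>
  have "card (A \<inter> {..<n}) + card ({..<n} - A) = n"
    using card_Int_Diff[of "{..<n}" A] by (simp add: Int_commute)
  moreover have "card (A \<inter> {..<n}) \<le> card A"
    using A by (intro card_mono) auto
  moreover have "length ?gaps = card ({..<n} - A)"
  proof -
    have "set ?gaps = {..<n} - A"
      by auto
    then show ?thesis
      using distinct_card[of ?gaps] by simp
  qed
  ultimately have "n \<le> card A + length ?gaps"
    by linarith
  then show ?case
    using Suc by (simp add: cofaces_append partial_shift_emb sch_coface_mem)
qed (simp add: x)

lemma labeled_subspace_eq:
  assumes A: "finite A"
  shows "labeled_subspace H \<delta> \<iota> A = label_space A"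
proof -
  let ?gaps = "filter (\<lambda>i. i \<notin> A) [0..<shifted_level A]"
  have set: "set ?gaps = {..<shifted_level A} - A"
    by auto
  have gaps: "sorted_list_of_set ({..<shifted_level A} - A) = ?gaps"
    using sorted_wrt_filter[of "(\<le>)" "[0..<shifted_level A]" "\<lambda>i. i \<notin> A"] set
    by (intro sorted_distinct_set_unique) auto
  have "card A + length ?gaps = shifted_level A"
  proof -
    have "length ?gaps = card ({..<shifted_level A} - A)"
      using distinct_card[of ?gaps] set by simp
    then show ?thesis
      using A subset_shifted_level[OF A] card_mono[OF _ subset_shifted_level[OF A]]
      by (simp add: card_Diff_subset)
  qed
  then have "label_map A (\<iota> (card A) x) = \<iota> (shifted_level A) (cofaces \<delta> (card A) ?gaps x)"
    if "x \<in> H (card A)" for x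
    using fill_eq_cofaces[OF A that, of "shifted_level A"] by (simp add: label_map_def)
  moreover have "root_subspace H \<delta> (card A) \<subseteq> H (card A)"
    by (auto simp: root_subspace_def)
  ultimately show ?thesis
    unfolding labeled_subspace_def label_space_def root_space_eq gaps image_image
    by (intro image_cong) auto
qed

lemma orthogonal_labels_iff:
  "orthogonal_labels \<longleftrightarrow>
    (\<forall>A B. finite A \<and> finite B \<and> A \<noteq> B \<longrightarrow>
      orthogonal_sets (labeled_subspace H \<delta> \<iota> A) (labeled_subspace H \<delta> \<iota> B))"
  unfolding orthogonal_labels_def by (simp add: labeled_subspace_eq cong: conj_cong)

lemma normal_imp_symmetric:
  assumes normal: normal_tower
  shows "symmetric_sch H \<delta> \<iota> \<and> saturated_sch H \<delta> \<iota>"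
proof -
  note orth = normal_imp_orthogonal_labels[OF normal]
  have sat: "saturation_tower H \<delta> \<iota> n = \<iota> n ` H n" for n
    using shift_fixed_imp_T[OF orth] shift_fixed T_M unfolding saturation_tower_def by blast
  then have "saturation_is_canonical H \<delta> \<iota> (H_infinity H \<iota>) (\<lambda>m. act (symmetric_gen m))"
    using shift_eq_canonical_shift[OF orth] unfolding saturation_is_canonical_def
    by (simp add: canonical_tower_gen[OF orth])
  then show ?thesis
    using act_unitary_rep[OF orth] sat unfolding symmetric_sch_def saturated_sch_def by blast
qed

lemma braided_imp_normal:
  assumes braided: "braided_sch H \<delta> \<iota>" and sat: "saturated_sch H \<delta> \<iota>"
  shows normal_tower
proof -
  obtain K U where U: "unitary_rep braid_group K U"
    and canonical: "saturation_is_canonical H \<delta> \<iota> K (\<lambda>m. U (braid_gen m))"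
    using braided by (auto simp: braided_sch_def)
  \<comment> \<open>Saturation replaces the tower of the saturation by the given one.\<close>
  have T_eq: "\<iota> n ` H n = canonical_tower K (\<lambda>m. U (braid_gen m)) n" for n
    using sat canonical by (simp add: saturated_sch_def saturation_is_canonical_def)
  interpret braid_unitaries K "\<lambda>m. U (braid_gen m)"
    by (rule braid_unitaries_rep[OF U])
  interpret braided_tower "H_infinity H \<iota>" "\<lambda>n. \<iota> n ` H n" "partial_shift H \<delta> \<iota>" K
      "\<lambda>m. U (braid_gen m)"
    by unfold_locales (use canonical in \<open>auto simp: T_eq saturation_is_canonical_def\<close>)
  show ?thesis
    by (rule normal)
qed

end

end

theorem theorem6p5:
  fixes H :: "nat \<Rightarrow> 'a::chilbert_space set"
    and \<delta> :: "nat \<Rightarrow> nat \<Rightarrow> 'a \<Rightarrow> 'a"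
    and \<iota> :: "nat \<Rightarrow> 'a \<Rightarrow> 'b::chilbert_space"
  assumes "sch H \<delta>"
    and "tower_embedding H \<delta> \<iota>"
  shows "(symmetric_sch H \<delta> \<iota> \<and> saturated_sch H \<delta> \<iota> \<longleftrightarrow> normal_sch H \<delta>) \<and>
    (braided_sch H \<delta> \<iota> \<and> saturated_sch H \<delta> \<iota> \<longleftrightarrow> normal_sch H \<delta>) \<and>
    ((\<forall>k i j. i < j \<and> j \<le> k + 1 \<and> i \<le> k \<longrightarrow>
        \<delta> (Suc k) j ` (H (Suc k) \<ominus>\<^sub>H \<delta> k i ` H k) \<subseteq>
          H (Suc (Suc k)) \<ominus>\<^sub>H \<delta> (Suc k) i ` H (Suc k)) \<longleftrightarrow> normal_sch H \<delta>) \<and>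
    ((\<forall>A B. finite A \<and> finite B \<and> A \<noteq> B \<longrightarrow>
        orthogonal_sets (labeled_subspace H \<delta> \<iota> A) (labeled_subspace H \<delta> \<iota> B)) \<longleftrightarrow>
      normal_sch H \<delta>)"
proof -
  interpret shift_tower "H_infinity H \<iota>" "\<lambda>n. \<iota> n ` H n" "partial_shift H \<delta> \<iota>"
    by (rule shift_tower_sch[OF assms])
  have normal: "normal_sch H \<delta> \<longleftrightarrow> normal_tower"
    using normal_sch_iff[OF assms(1)] normal_tower_iff[OF assms] by simp
  \<comment> \<open>The cycle normal, symmetric and saturated, braided and saturated, normal closes
    here.\<close>
  have braided: "braided_sch H \<delta> \<iota> \<and> saturated_sch H \<delta> \<iota> \<longleftrightarrow> normal_sch H \<delta>"
    unfolding normal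
    using normal_imp_symmetric[OF assms] braided_imp_normal[OF assms] symmetric_imp_braided by blast
  moreover have "symmetric_sch H \<delta> \<iota> \<and> saturated_sch H \<delta> \<iota> \<longleftrightarrow> normal_sch H \<delta>"
    using braided symmetric_imp_braided normal_imp_symmetric[OF assms] unfolding normal by blast
  moreover have "orthogonal_labels \<longleftrightarrow> normal_sch H \<delta>"
    unfolding normal using normal_imp_orthogonal_labels orthogonal_labels_imp_normal by blast
  ultimately show ?thesis
    unfolding orthogonal_labels_iff[OF assms] preserves_complements_iff[OF assms(1), symmetric]
      normal_sch_iff[OF assms(1), symmetric] by (intro conjI HOL.refl)
qed

end
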